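(* (1) A sample space $(\mathbb R^n,\mathcal N(\mu,\Sigma))$ in $\mathbf{Gauss}$ is faithful if and only if $\Sigma$ has full rank, i.e. is positive definite. Every such (faithful) sample space is isomorphic to a standard sample space, i.e. one of the form $(\mathbb R^n,\mathcal N(0,I_n))$, by means of Cholesky decomposition, i.e. a factorization $\Sigma=LL^T$. (2) The category $\mathcal P(\mathbf{Gauss})$ is dagger equivalent to $\mathbf{Con}$. (3) The category $\mathcal S(\mathbf{Gauss})$ is equivalent to $\mathbf{CoIsom}$.
   Context: $\mathbf{Gauss}$ is the category with objects the spaces $\mathbb R^n$ ($n\in\mathbb N$) and morphisms $\mathbb R^m\to\mathbb R^n$ the triples $(A,b,\Sigma)$ with $A\in\mathbb R^{n\times m}$, $b\in\mathbb R^n$, $\Sigma\in\mathbb R^{n\times n}$ positive semidefinite, representing the kernel $x\mapsto Ax+\mathcal N(b,\Sigma)$; composition is $(A,b,\Sigma)\circ(C,d,\Xi)=(AC,\,b+Ad,\,\Sigma+A\Xi A^T)$. It is a Markov category with $\mathbb R^m\otimes\mathbb R^n=\mathbb R^{m+n}$, tensor of morphisms given by block-diagonal matrices and concatenated vectors, unit $I=\mathbb R^0$, and $\mathrm{copy}$ the noiseless linear map $x\mapsto(x,x)$. A state $I\to\mathbb R^n$ is a Gaussian distribution $\mathcal N(\mu,\Sigma)$. $\mathbf{Con}$ and $\mathbf{CoIsom}$ are the categories with objects natural numbers and morphisms $m\to n$ the matrices $A\in\mathbb R^{n\times m}$ that are, respectively, contractions ($\|Ax\|\le\|x\|$ for all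 $x\in\mathbb R^m$, Euclidean norm) and co-isometries ($AA^T=I_n$), with matrix multiplication as composition. $\mathbf{Con}$ is a dagger category under transposition. For a Markov category $\mathsf C$ (with conditionals, as holds here): for a state $p:I\to X$ and $f,g:X\to Y$, $f=_pg$ ($p$-almost sure equality) means $(\mathrm{id}_X\otimes f)\circ\mathrm{copy}_X\circ p=(\mathrm{id}_X\otimes g)\circ\mathrm{copy}_X\circ p$; $f$ is $p$-almost surely deterministic if $\mathrm{copy}_Y\circ f=_p(f\otimes f)\circ\mathrm{copy}_X$. $\mathcal P(\mathsf C)$ has as objects probability spaces (also called sample spaces) $(\Omega,p)$ with $p:I\to\Omega$ a state, and as morphisms $(\Omega,p)\to(\Omega',q)$ the $p$-almost sure equality classes of $f:\Omega\to\Omega'$ with $f\circ p=q$. $\mathcal S(\mathsf C)$ is its wide subcategory of classes of $p$-almost surely deterministic morphisms. An object $(\Omega,p)$ is faithful if for all objects $X$ and $f,g:\Omega\to X$ in $\mathsf C$, $f=_pg$ implies $f=g$. $\mathcal P(\mathsf C)$ is a dagger category under Bayesian inversion: for $f:(X,p)\to(Y,q)$, $f^\dagger:(Y,q)\to(X,p)$ is the class of any $f^\dagger_p:Y\to X$ with $(\mathrm{id}_X\otimes f)\circ\mathrm{copy}_X\circ p=(f_p^\dagger\otimes\mathrm{id}_Y)\circ\mathrm{copy}_Y\circ f\circ p$. A dagger equivalence consists of dagger-preserving functors $F,G$ and natural isomorphisms $FG\cong 1$, $GF\cong 1$ whose components are unitary ($f^{-1}=f^\dagger$). *)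

theory Defs
  imports "Jordan_Normal_Form.DL_Rank"
begin

section \<open>Categories, dagger categories and their equivalences\<close>

text \<open>
  Morphisms do not carry their domain and codomain, so operations on them take the objects as
  arguments: \<open>Comp C X Y Z g f\<close> is \<open>g \<circ> f\<close> for \<open>f : X \<rightarrow> Y\<close> and \<open>g : Y \<rightarrow> Z\<close>.
\<close>

record ('o, 'm) category_data =
  Ob :: "'o set"
  Mor :: "'o \<Rightarrow> 'o \<Rightarrow> 'm set"
  Ident :: "'o \<Rightarrow> 'm"
  Comp :: "'o \<Rightarrow> 'o \<Rightarrow> 'o \<Rightarrow> 'm \<Rightarrow> 'm \<Rightarrow> 'm"

locale category =
  fixes C :: "('o, 'm, 'z) category_data_scheme"
  assumes ident_mor: "X \<in> Ob C \<Longrightarrow> Ident C X \<in> Mor C X X"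
    and comp_mor: "\<lbrakk>X \<in> Ob C; Y \<in> Ob C; Z \<in> Ob C; f \<in> Mor C X Y; g \<in> Mor C Y Z\<rbrakk>
      \<Longrightarrow> Comp C X Y Z g f \<in> Mor C X Z"
    and comp_ident: "\<lbrakk>X \<in> Ob C; Y \<in> Ob C; f \<in> Mor C X Y\<rbrakk> \<Longrightarrow> Comp C X X Y f (Ident C X) = f"
    and ident_comp: "\<lbrakk>X \<in> Ob C; Y \<in> Ob C; f \<in> Mor C X Y\<rbrakk> \<Longrightarrow> Comp C X Y Y (Ident C Y) f = f"
    and comp_assoc: "\<lbrakk>W \<in> Ob C; X \<in> Ob C; Y \<in> Ob C; Z \<in> Ob C;
        f \<in> Mor C W X; g \<in> Mor C X Y; h \<in> Mor C Y Z\<rbrakk>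
      \<Longrightarrow> Comp C W X Z (Comp C X Y Z h g) f = Comp C W Y Z h (Comp C W X Y g f)"

definition inverses ::
    "('o, 'm, 'z) category_data_scheme \<Rightarrow> 'o \<Rightarrow> 'o \<Rightarrow> 'm \<Rightarrow> 'm \<Rightarrow> bool" where
  "inverses C X Y f g \<longleftrightarrow> f \<in> Mor C X Y \<and> g \<in> Mor C Y X \<and>
     Comp C X Y X g f = Ident C X \<and> Comp C Y X Y f g = Ident C Y"

definition isomorphism :: "('o, 'm, 'z) category_data_scheme \<Rightarrow> 'o \<Rightarrow> 'o \<Rightarrow> 'm \<Rightarrow> bool" where
  "isomorphism C X Y f \<longleftrightarrow> (\<exists>g. inverses C X Y f g)"

record ('o, 'm, 'p, 'n) functor_data =
  FOb :: "'o \<Rightarrow> 'p"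
  FMor :: "'o \<Rightarrow> 'o \<Rightarrow> 'm \<Rightarrow> 'n"

definition id_functor :: "('o, 'm, 'o, 'm) functor_data" where
  "id_functor = \<lparr>FOb = (\<lambda>X. X), FMor = (\<lambda>X Y f. f)\<rparr>"

definition comp_functor :: "('p, 'n, 'q, 'k) functor_data \<Rightarrow> ('o, 'm, 'p, 'n) functor_data
    \<Rightarrow> ('o, 'm, 'q, 'k) functor_data" where
  "comp_functor G F =
     \<lparr>FOb = (\<lambda>X. FOb G (FOb F X)), FMor = (\<lambda>X Y f. FMor G (FOb F X) (FOb F Y) (FMor F X Y f))\<rparr>"

locale is_functor = source: category C + target: category D
  for C :: "('o, 'm, 'y) category_data_scheme" and D :: "('p, 'n, 'z) category_data_scheme" +
  fixes F :: "('o, 'm, 'p, 'n) functor_data"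
  assumes FOb: "X \<in> Ob C \<Longrightarrow> FOb F X \<in> Ob D"
    and FMor: "\<lbrakk>X \<in> Ob C; Y \<in> Ob C; f \<in> Mor C X Y\<rbrakk>
      \<Longrightarrow> FMor F X Y f \<in> Mor D (FOb F X) (FOb F Y)"
    and FMor_ident: "X \<in> Ob C \<Longrightarrow> FMor F X X (Ident C X) = Ident D (FOb F X)"
    and FMor_comp: "\<lbrakk>X \<in> Ob C; Y \<in> Ob C; Z \<in> Ob C; f \<in> Mor C X Y; g \<in> Mor C Y Z\<rbrakk>
      \<Longrightarrow> FMor F X Z (Comp C X Y Z g f)
        = Comp D (FOb F X) (FOb F Y) (FOb F Z) (FMor F Y Z g) (FMor F X Y f)"

definition natural_iso :: "('o, 'm, 'y) category_data_scheme \<Rightarrow> ('p, 'n, 'z) category_data_scheme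
    \<Rightarrow> ('o, 'm, 'p, 'n) functor_data \<Rightarrow> ('o, 'm, 'p, 'n) functor_data \<Rightarrow> ('o \<Rightarrow> 'n) \<Rightarrow> bool" where
  "natural_iso C D F G \<eta> \<longleftrightarrow>
     (\<forall>X\<in>Ob C. isomorphism D (FOb F X) (FOb G X) (\<eta> X)) \<and>
     (\<forall>X\<in>Ob C. \<forall>Y\<in>Ob C. \<forall>f\<in>Mor C X Y.
        Comp D (FOb F X) (FOb F Y) (FOb G Y) (\<eta> Y) (FMor F X Y f)
        = Comp D (FOb F X) (FOb G X) (FOb G Y) (FMor G X Y f) (\<eta> X))"

definition equivalent_categories ::
    "('o, 'm, 'y) category_data_scheme \<Rightarrow> ('p, 'n, 'z) category_data_scheme \<Rightarrow> bool" where
  "equivalent_categories C D \<longleftrightarrow> (\<exists>F G \<eta> \<epsilon>.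
     is_functor C D F \<and> is_functor D C G \<and>
     natural_iso C C (comp_functor G F) id_functor \<eta> \<and>
     natural_iso D D (comp_functor F G) id_functor \<epsilon>)"

record ('o, 'm) dagger_data = "('o, 'm) category_data" +
  Dag :: "'o \<Rightarrow> 'o \<Rightarrow> 'm \<Rightarrow> 'm"

locale dagger_category = category C for C :: "('o, 'm, 'z) dagger_data_scheme" +
  assumes dag_mor: "\<lbrakk>X \<in> Ob C; Y \<in> Ob C; f \<in> Mor C X Y\<rbrakk> \<Longrightarrow> Dag C X Y f \<in> Mor C Y X"
    and dag_ident: "X \<in> Ob C \<Longrightarrow> Dag C X X (Ident C X) = Ident C X"
    and dag_comp: "\<lbrakk>X \<in> Ob C; Y \<in> Ob C; Z \<in> Ob C; f \<in> Mor C X Y; g \<in> Mor C Y Z\<rbrakk>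
      \<Longrightarrow> Dag C X Z (Comp C X Y Z g f) = Comp C Z Y X (Dag C X Y f) (Dag C Y Z g)"
    and dag_dag: "\<lbrakk>X \<in> Ob C; Y \<in> Ob C; f \<in> Mor C X Y\<rbrakk> \<Longrightarrow> Dag C Y X (Dag C X Y f) = f"

locale dagger_functor = is_functor C D F + source: dagger_category C + target: dagger_category D
  for C :: "('o, 'm, 'y) dagger_data_scheme" and D :: "('p, 'n, 'z) dagger_data_scheme" and F +
  assumes FMor_dag: "\<lbrakk>X \<in> Ob C; Y \<in> Ob C; f \<in> Mor C X Y\<rbrakk>
      \<Longrightarrow> FMor F Y X (Dag C X Y f) = Dag D (FOb F X) (FOb F Y) (FMor F X Y f)"

definition unitary :: "('o, 'm, 'z) dagger_data_scheme \<Rightarrow> 'o \<Rightarrow> 'o \<Rightarrow> 'm \<Rightarrow> bool" where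
  "unitary C X Y f \<longleftrightarrow> inverses C X Y f (Dag C X Y f)"

definition dagger_equivalent ::
    "('o, 'm, 'y) dagger_data_scheme \<Rightarrow> ('p, 'n, 'z) dagger_data_scheme \<Rightarrow> bool" where
  "dagger_equivalent C D \<longleftrightarrow> (\<exists>F G \<eta> \<epsilon>.
     dagger_functor C D F \<and> dagger_functor D C G \<and>
     natural_iso C C (comp_functor G F) id_functor \<eta> \<and>
     natural_iso D D (comp_functor F G) id_functor \<epsilon> \<and>
     (\<forall>X\<in>Ob C. unitary C (FOb (comp_functor G F) X) X (\<eta> X)) \<and>
     (\<forall>Y\<in>Ob D. unitary D (FOb (comp_functor F G) Y) Y (\<epsilon> Y)))"


section \<open>Probability spaces in a Markov category\<close>

text \<open>
  The part of the structure of a Markov category that enters the definitions below.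
  \<open>TenMor C X X' Y Y' f g\<close> is \<open>f \<otimes> g : X \<otimes> Y \<rightarrow> X' \<otimes> Y'\<close> for \<open>f : X \<rightarrow> X'\<close> and \<open>g : Y \<rightarrow> Y'\<close>.
\<close>

record ('o, 'm) markov_data = "('o, 'm) category_data" +
  Unit :: 'o
  TenOb :: "'o \<Rightarrow> 'o \<Rightarrow> 'o"
  TenMor :: "'o \<Rightarrow> 'o \<Rightarrow> 'o \<Rightarrow> 'o \<Rightarrow> 'm \<Rightarrow> 'm \<Rightarrow> 'm"
  Copy :: "'o \<Rightarrow> 'm"

text \<open>\<open>graph_state C X Y p f\<close> is \<open>(id\<^sub>X \<otimes> f) \<circ> copy\<^sub>X \<circ> p\<close>, and
  \<open>cograph_state C X Y q g\<close> is \<open>(g \<otimes> id\<^sub>Y) \<circ> copy\<^sub>Y \<circ> q\<close> for \<open>g : Y \<rightarrow> X\<close>.\<close>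

definition graph_state ::
    "('o, 'm, 'z) markov_data_scheme \<Rightarrow> 'o \<Rightarrow> 'o \<Rightarrow> 'm \<Rightarrow> 'm \<Rightarrow> 'm" where
  "graph_state C X Y p f =
     Comp C (Unit C) (TenOb C X X) (TenOb C X Y)
       (TenMor C X X X Y (Ident C X) f)
       (Comp C (Unit C) X (TenOb C X X) (Copy C X) p)"

definition cograph_state ::
    "('o, 'm, 'z) markov_data_scheme \<Rightarrow> 'o \<Rightarrow> 'o \<Rightarrow> 'm \<Rightarrow> 'm \<Rightarrow> 'm" where
  "cograph_state C X Y q g =
     Comp C (Unit C) (TenOb C Y Y) (TenOb C X Y)
       (TenMor C Y X Y Y g (Ident C Y))
       (Comp C (Unit C) Y (TenOb C Y Y) (Copy C Y) q)"

definition as_eq ::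
    "('o, 'm, 'z) markov_data_scheme \<Rightarrow> 'o \<Rightarrow> 'o \<Rightarrow> 'm \<Rightarrow> 'm \<Rightarrow> 'm \<Rightarrow> bool" where
  "as_eq C X Y p f g \<longleftrightarrow> graph_state C X Y p f = graph_state C X Y p g"

definition as_class ::
    "('o, 'm, 'z) markov_data_scheme \<Rightarrow> 'o \<Rightarrow> 'o \<Rightarrow> 'm \<Rightarrow> 'm \<Rightarrow> 'm set" where
  "as_class C X Y p f = {g \<in> Mor C X Y. as_eq C X Y p f g}"

definition as_deterministic ::
    "('o, 'm, 'z) markov_data_scheme \<Rightarrow> 'o \<Rightarrow> 'o \<Rightarrow> 'm \<Rightarrow> 'm \<Rightarrow> bool" where
  "as_deterministic C X Y p f \<longleftrightarrow>
     as_eq C X (TenOb C Y Y) p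
       (Comp C X Y (TenOb C Y Y) (Copy C Y) f)
       (Comp C X (TenOb C X X) (TenOb C Y Y) (TenMor C X Y X Y f f) (Copy C X))"

definition faithful :: "('o, 'm, 'z) markov_data_scheme \<Rightarrow> 'o \<times> 'm \<Rightarrow> bool" where
  "faithful C = (\<lambda>(W, p). \<forall>X\<in>Ob C. \<forall>f\<in>Mor C W X. \<forall>g\<in>Mor C W X. as_eq C W X p f g \<longrightarrow> f = g)"

definition bayesian_inverse ::
    "('o, 'm, 'z) markov_data_scheme \<Rightarrow> 'o \<Rightarrow> 'o \<Rightarrow> 'm \<Rightarrow> 'm \<Rightarrow> 'm \<Rightarrow> bool" where
  "bayesian_inverse C X Y p f g \<longleftrightarrow> g \<in> Mor C Y X \<and>
     graph_state C X Y p f = cograph_state C X Y (Comp C (Unit C) X Y f p) g"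

text \<open>
  In \<open>prob_spaces\<close>, composition and dagger of almost sure equality classes are the unions of the
  classes obtained from all choices of representatives. In a Markov category with conditionals
  these classes coincide, so the union is again a single class.
\<close>

definition prob_spaces :: "('o, 'm, 'z) markov_data_scheme \<Rightarrow> ('o \<times> 'm, 'm set) dagger_data" where
  "prob_spaces C = \<lparr>
     Ob = {(W, p). W \<in> Ob C \<and> p \<in> Mor C (Unit C) W},
     Mor = (\<lambda>(X, p) (Y, q). {as_class C X Y p f | f. f \<in> Mor C X Y \<and> Comp C (Unit C) X Y f p = q}),
     Ident = (\<lambda>(X, p). as_class C X X p (Ident C X)),
     Comp = (\<lambda>(X, p) (Y, q) (Z, r) \<beta> \<alpha>. \<Union>g\<in>\<beta>. \<Union>f\<in>\<alpha>. as_class C X Z p (Comp C X Y Z g f)),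
     Dag = (\<lambda>(X, p) (Y, q) \<alpha>. \<Union>f\<in>\<alpha>. \<Union>g\<in>{g. bayesian_inverse C X Y p f g}. as_class C Y X q g)\<rparr>"

definition sample_spaces :: "('o, 'm, 'z) markov_data_scheme \<Rightarrow> ('o \<times> 'm, 'm set) category_data" where
  "sample_spaces C = \<lparr>
     Ob = Ob (prob_spaces C),
     Mor = (\<lambda>(X, p) (Y, q). {as_class C X Y p f | f.
        f \<in> Mor C X Y \<and> Comp C (Unit C) X Y f p = q \<and> as_deterministic C X Y p f}),
     Ident = Ident (prob_spaces C),
     Comp = Comp (prob_spaces C)\<rparr>"


section \<open>Matrices\<close>

definition positive_semidefinite :: "real mat \<Rightarrow> bool" where
  "positive_semidefinite S \<longleftrightarrow> transpose_mat S = S \<and>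
     (\<forall>x\<in>carrier_vec (dim_row S). 0 \<le> x \<bullet> (S *\<^sub>v x))"

definition positive_definite :: "real mat \<Rightarrow> bool" where
  "positive_definite S \<longleftrightarrow> transpose_mat S = S \<and>
     (\<forall>x\<in>carrier_vec (dim_row S). x \<noteq> 0\<^sub>v (dim_row S) \<longrightarrow> 0 < x \<bullet> (S *\<^sub>v x))"

definition cholesky_factor :: "nat \<Rightarrow> real mat \<Rightarrow> real mat \<Rightarrow> bool" where
  "cholesky_factor n S L \<longleftrightarrow> L \<in> carrier_mat n n \<and> upper_triangular (transpose_mat L) \<and>
     (\<forall>i<n. 0 < L $$ (i, i)) \<and> S = L * transpose_mat L"

definition euclidean_norm :: "real vec \<Rightarrow> real" where
  "euclidean_norm x = sqrt (x \<bullet> x)"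

definition contraction :: "real mat \<Rightarrow> bool" where
  "contraction A \<longleftrightarrow>
     (\<forall>x\<in>carrier_vec (dim_col A). euclidean_norm (A *\<^sub>v x) \<le> euclidean_norm x)"

definition block_diag :: "real mat \<Rightarrow> real mat \<Rightarrow> real mat" where
  "block_diag A B =
     four_block_mat A (0\<^sub>m (dim_row A) (dim_col B)) (0\<^sub>m (dim_row B) (dim_col A)) B"


section \<open>The concrete categories\<close>

type_synonym gauss = "real mat \<times> real vec \<times> real mat"

text \<open>The object \<open>n\<close> stands for \<open>\<real>\<^sup>n\<close>.\<close>

definition Gauss :: "(nat, gauss) markov_data" where
  "Gauss = \<lparr>
     Ob = UNIV,
     Mor = (\<lambda>m n. {(A, b, S). A \<in> carrier_mat n m \<and> b \<in> carrier_vec n \<and>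
        S \<in> carrier_mat n n \<and> positive_semidefinite S}),
     Ident = (\<lambda>n. (1\<^sub>m n, 0\<^sub>v n, 0\<^sub>m n n)),
     Comp = (\<lambda>_ _ _ (A, b, S) (B, d, T).
        (A * B, b + A *\<^sub>v d, S + A * T * transpose_mat A)),
     Unit = 0,
     TenOb = (+),
     TenMor = (\<lambda>_ _ _ _ (A, b, S) (B, d, T). (block_diag A B, b @\<^sub>v d, block_diag S T)),
     Copy = (\<lambda>n. (1\<^sub>m n @\<^sub>r 1\<^sub>m n, 0\<^sub>v (n + n), 0\<^sub>m (n + n) (n + n)))\<rparr>"

definition normal_state :: "nat \<Rightarrow> real vec \<Rightarrow> real mat \<Rightarrow> gauss" where
  "normal_state n b S = (0\<^sub>m n 0, b, S)"

definition standard_space :: "nat \<Rightarrow> nat \<times> gauss" where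
  "standard_space n = (n, normal_state n (0\<^sub>v n) (1\<^sub>m n))"

definition Con :: "(nat, real mat) dagger_data" where
  "Con = \<lparr>
     Ob = UNIV,
     Mor = (\<lambda>m n. {A \<in> carrier_mat n m. contraction A}),
     Ident = (\<lambda>n. 1\<^sub>m n),
     Comp = (\<lambda>_ _ _ A B. A * B),
     Dag = (\<lambda>_ _ A. transpose_mat A)\<rparr>"

definition CoIsom :: "(nat, real mat) category_data" where
  "CoIsom = \<lparr>
     Ob = UNIV,
     Mor = (\<lambda>m n. {A \<in> carrier_mat n m. A * transpose_mat A = 1\<^sub>m n}),
     Ident = (\<lambda>n. 1\<^sub>m n),
     Comp = (\<lambda>_ _ _ A B. A * B)\<rparr>"

end

theory Submission
  imports Defs
begin

text \<open>
  A positive semidefinite covariance matrix factors as \<open>\<Sigma> = L L\<^sup>T\<close>, where \<open>L\<close> has a left inverse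
  \<open>K\<close> and as many columns as \<open>\<Sigma>\<close> has rank. Then \<open>(L, \<mu>, 0)\<close> and \<open>(K, - K \<mu>, 0)\<close> are
  mutually inverse up to almost sure equality, so \<open>N(\<mu>, \<Sigma>)\<close> is isomorphic to the standard
  space whose dimension is the rank of \<open>\<Sigma>\<close>, and everything can be computed in the coordinates given by \<open>L\<close>.

  Let \<open>f = (A, b, S)\<close> carry \<open>N(\<mu>, L L\<^sup>T)\<close> to \<open>N(\<nu>, L' L'\<^sup>T)\<close>. Two such kernels are almost
  surely equal iff they give the same joint distribution, that is iff they have the same cross
  covariance \<open>A L L\<^sup>T\<close>, or equivalently the same \<open>A L\<close>; the means and the noise are then forced
  by the target distribution. The identity \<open>L' L'\<^sup>T = S + (A L) (A L)\<^sup>T\<close> shows that the noise and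
  the signal both live in the range of \<open>L'\<close>: it gives \<open>A L = L' M\<close> for a unique \<open>M\<close>, with
  \<open>S = L' (I - M M\<^sup>T) L'\<^sup>T\<close>. Such an \<open>S\<close> is a covariance matrix iff \<open>M\<close> is a contraction, and it
  vanishes iff \<open>M\<close> is a co-isometry; vanishing noise is almost sure determinism. So almost sure
  classes correspond to contractions and deterministic classes to co-isometries (lemmas
  \<open>pushforward_coordinates\<close>, \<open>prob_spaces_Mor\<close>, \<open>sample_spaces_Mor\<close>). Composition becomes the
  matrix product, and Bayesian inversion, which swaps the two halves of the joint distribution,
  transposes the cross covariance and hence \<open>M\<close> (\<open>Comp_gauss_class\<close>, \<open>bayesian_inverse_iff\<close>).

  The two equivalences then follow formally: a category whose hom-sets are relabelled hom-sets
  of another one is equivalent to it once every object of the latter is represented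
  (locales \<open>presented_category\<close> and \<open>presented_dagger_category\<close>).

  As for faithfulness, almost sure equality sees the affine part of a kernel only through its
  action on the range of \<open>\<Sigma>\<close> and on the mean; a null vector of \<open>\<Sigma>\<close> yields two different kernels that agree there.
  The induction that produces \<open>L\<close> eliminates one variable at a time by a Schur complement. For
  positive definite \<open>\<Sigma>\<close> every pivot is positive, and then \<open>L\<close> is the Cholesky factor.
\<close>

section \<open>Categories presented by another category\<close>

text \<open>
  The morphisms of \<open>E\<close> from \<open>X\<close> to \<open>Y\<close> are the \<open>cl X Y g\<close> for a unique \<open>D\<close>-morphism \<open>g\<close> between
  the objects \<open>rk X\<close> and \<open>rk Y\<close>. The category laws of \<open>E\<close> follow, as those of \<open>D\<close> transfer along
  these bijections. The objects \<open>st n\<close> are required to lie strictly over \<open>n\<close>, which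
  makes the counit of the equivalence an identity.
\<close>

locale presented_category = D: category D
  for D :: "('b, 'g, 'z) category_data_scheme" +
  fixes E :: "('a, 'f, 'y) category_data_scheme"
    and rk :: "'a \<Rightarrow> 'b" and cl :: "'a \<Rightarrow> 'a \<Rightarrow> 'g \<Rightarrow> 'f" and st :: "'b \<Rightarrow> 'a"
  assumes rk: "X \<in> Ob E \<Longrightarrow> rk X \<in> Ob D"
    and cl_bij: "\<lbrakk>X \<in> Ob E; Y \<in> Ob E\<rbrakk> \<Longrightarrow> bij_betw (cl X Y) (Mor D (rk X) (rk Y)) (Mor E X Y)"
    and cl_ident: "X \<in> Ob E \<Longrightarrow> Ident E X = cl X X (Ident D (rk X))"
    and cl_comp: "\<lbrakk>X \<in> Ob E; Y \<in> Ob E; Z \<in> Ob E; f \<in> Mor D (rk X) (rk Y); g \<in> Mor D (rk Y) (rk Z)\<rbrakk>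
      \<Longrightarrow> Comp E X Y Z (cl Y Z g) (cl X Y f) = cl X Z (Comp D (rk X) (rk Y) (rk Z) g f)"
    and st: "n \<in> Ob D \<Longrightarrow> st n \<in> Ob E"
    and rk_st: "n \<in> Ob D \<Longrightarrow> rk (st n) = n"
begin

definition coord :: "'a \<Rightarrow> 'a \<Rightarrow> 'f \<Rightarrow> 'g" where
  "coord X Y = inv_into (Mor D (rk X) (rk Y)) (cl X Y)"

lemma cl_mor:
  assumes "X \<in> Ob E" "Y \<in> Ob E" "g \<in> Mor D (rk X) (rk Y)"
  shows "cl X Y g \<in> Mor E X Y"
  using bij_betwE[OF cl_bij] assms by blast

lemma coord_cl:
  assumes "X \<in> Ob E" "Y \<in> Ob E" "g \<in> Mor D (rk X) (rk Y)"
  shows "coord X Y (cl X Y g) = g"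
  unfolding coord_def using bij_betw_inv_into_left[OF cl_bij] assms by blast

lemma mor_cases:
  assumes "X \<in> Ob E" "Y \<in> Ob E" "f \<in> Mor E X Y"
  obtains g where "g \<in> Mor D (rk X) (rk Y)" "f = cl X Y g"
  using bij_betw_imp_surj_on[OF cl_bij[OF assms(1,2)]] assms(3) by blast

sublocale category E
proof
  fix X assume X: "X \<in> Ob E"
  show "Ident E X \<in> Mor E X X"
    using X by (simp add: cl_ident cl_mor rk D.ident_mor)
next
  fix X Y Z f g
  assume o: "X \<in> Ob E" "Y \<in> Ob E" "Z \<in> Ob E" and f: "f \<in> Mor E X Y" and g: "g \<in> Mor E Y Z"
  obtain f' g' where "f' \<in> Mor D (rk X) (rk Y)" "f = cl X Y f'" "g' \<in> Mor D (rk Y) (rk Z)" "g = cl Y Z g'"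
    using o f g by (metis mor_cases)
  then show "Comp E X Y Z g f \<in> Mor E X Z"
    using o by (simp add: cl_comp cl_mor rk D.comp_mor)
next
  fix X Y f
  assume o: "X \<in> Ob E" "Y \<in> Ob E" and f: "f \<in> Mor E X Y"
  obtain f' where "f' \<in> Mor D (rk X) (rk Y)" "f = cl X Y f'"
    using o f by (metis mor_cases)
  then show "Comp E X X Y f (Ident E X) = f" "Comp E X Y Y (Ident E Y) f = f"
    using o by (simp_all add: cl_comp cl_ident rk D.ident_mor D.comp_ident D.ident_comp)
next
  fix W X Y Z f g h
  assume o: "W \<in> Ob E" "X \<in> Ob E" "Y \<in> Ob E" "Z \<in> Ob E"
    and m: "f \<in> Mor E W X" "g \<in> Mor E X Y" "h \<in> Mor E Y Z"
  obtain f' g' h' where "f' \<in> Mor D (rk W) (rk X)" "f = cl W X f'"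
      "g' \<in> Mor D (rk X) (rk Y)" "g = cl X Y g'" "h' \<in> Mor D (rk Y) (rk Z)" "h = cl Y Z h'"
    using o m by (metis mor_cases)
  then show "Comp E W X Z (Comp E X Y Z h g) f = Comp E W Y Z h (Comp E W X Y g f)"
    using o by (simp add: cl_comp rk D.comp_mor D.comp_assoc)
qed

definition coord_functor :: "('a, 'f, 'b, 'g) functor_data" where
  "coord_functor = \<lparr>FOb = rk, FMor = coord\<rparr>"

definition standard_functor :: "('b, 'g, 'a, 'f) functor_data" where
  "standard_functor = \<lparr>FOb = st, FMor = (\<lambda>m n. cl (st m) (st n))\<rparr>"

text \<open>
  The objects \<open>X\<close> and \<open>st (rk X)\<close> lie over the same object of \<open>D\<close>, so its identity labels an
  isomorphism between them.
\<close>

definition unit_component :: "'a \<Rightarrow> 'f" where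
  "unit_component X = cl (st (rk X)) X (Ident D (rk X))"

lemma coord_functor: "is_functor E D coord_functor"
proof
  fix X Y Z f g
  assume o: "X \<in> Ob E" "Y \<in> Ob E" "Z \<in> Ob E" and f: "f \<in> Mor E X Y" and g: "g \<in> Mor E Y Z"
  obtain f' g' where "f' \<in> Mor D (rk X) (rk Y)" "f = cl X Y f'" "g' \<in> Mor D (rk Y) (rk Z)" "g = cl Y Z g'"
    using o f g by (metis mor_cases)
  then show "FMor coord_functor X Z (Comp E X Y Z g f) = Comp D (FOb coord_functor X)
      (FOb coord_functor Y) (FOb coord_functor Z) (FMor coord_functor Y Z g) (FMor coord_functor X Y f)"
    using o by (simp add: coord_functor_def cl_comp coord_cl rk D.comp_mor)
next
  fix X Y f assume o: "X \<in> Ob E" "Y \<in> Ob E" and f: "f \<in> Mor E X Y"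
  obtain f' where "f' \<in> Mor D (rk X) (rk Y)" "f = cl X Y f'"
    using o f by (metis mor_cases)
  then show "FMor coord_functor X Y f \<in> Mor D (FOb coord_functor X) (FOb coord_functor Y)"
    using o by (simp add: coord_functor_def coord_cl)
qed (simp_all add: coord_functor_def rk cl_ident coord_cl D.ident_mor)

lemma standard_functor: "is_functor D E standard_functor"
  by unfold_locales
    (simp_all add: standard_functor_def st rk_st cl_ident cl_mor cl_comp)

lemma inverses_cl:
  assumes "X \<in> Ob E" "Y \<in> Ob E" "inverses D (rk X) (rk Y) f g"
  shows "inverses E X Y (cl X Y f) (cl Y X g)"
  using assms by (simp add: inverses_def cl_mor cl_comp cl_ident)

lemma inverses_Ident: "n \<in> Ob D \<Longrightarrow> inverses D n n (Ident D n) (Ident D n)"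
  by (simp add: inverses_def D.ident_mor D.ident_comp)

lemma unit_inverses:
  assumes "X \<in> Ob E"
  shows "inverses E (st (rk X)) X (unit_component X) (cl X (st (rk X)) (Ident D (rk X)))"
  unfolding unit_component_def using assms by (intro inverses_cl) (simp_all add: st rk rk_st inverses_Ident)

lemma unit_natural_iso: "natural_iso E E (comp_functor standard_functor coord_functor) id_functor unit_component"
  unfolding natural_iso_def
proof (intro conjI ballI)
  fix X assume "X \<in> Ob E"
  then show "isomorphism E (FOb (comp_functor standard_functor coord_functor) X) (FOb id_functor X) (unit_component X)"
    using unit_inverses
    by (auto simp: isomorphism_def comp_functor_def id_functor_def standard_functor_def coord_functor_def)
next
  fix X Y f assume o: "X \<in> Ob E" "Y \<in> Ob E" and f: "f \<in> Mor E X Y"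
  obtain f' where f': "f' \<in> Mor D (rk X) (rk Y)" "f = cl X Y f'"
    using o f by (metis mor_cases)
  have "Comp E (st (rk X)) (st (rk Y)) Y (unit_component Y) (cl (st (rk X)) (st (rk Y)) f')
      = cl (st (rk X)) Y f'"
    using o f' cl_comp[of "st (rk X)" "st (rk Y)" Y f' "Ident D (rk Y)"]
    by (simp add: unit_component_def st rk rk_st D.ident_comp D.ident_mor)
  moreover have "Comp E (st (rk X)) X Y f (unit_component X) = cl (st (rk X)) Y f'"
    using o f' cl_comp[of "st (rk X)" X Y "Ident D (rk X)" f']
    by (simp add: unit_component_def st rk rk_st D.comp_ident D.ident_mor)
  ultimately show "Comp E (FOb (comp_functor standard_functor coord_functor) X)
      (FOb (comp_functor standard_functor coord_functor) Y) (FOb id_functor Y) (unit_component Y)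
      (FMor (comp_functor standard_functor coord_functor) X Y f)
    = Comp E (FOb (comp_functor standard_functor coord_functor) X) (FOb id_functor X) (FOb id_functor Y)
      (FMor id_functor X Y f) (unit_component X)"
    using o f' by (simp add: comp_functor_def id_functor_def standard_functor_def coord_functor_def coord_cl)
qed

lemma counit_natural_iso: "natural_iso D D (comp_functor coord_functor standard_functor) id_functor (Ident D)"
  by (auto simp: natural_iso_def isomorphism_def comp_functor_def id_functor_def standard_functor_def
      coord_functor_def rk_st st coord_cl D.comp_ident D.ident_comp intro: inverses_Ident)

theorem equivalent: "equivalent_categories E D"
  unfolding equivalent_categories_def
  using coord_functor standard_functor unit_natural_iso counit_natural_iso by blast

end

locale presented_dagger_category = presented_category D E rk cl st + D: dagger_category D
  for D :: "('b, 'g, 'z) dagger_data_scheme" and E :: "('a, 'f, 'y) dagger_data_scheme" and rk cl st +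
  assumes cl_dag: "\<lbrakk>X \<in> Ob E; Y \<in> Ob E; f \<in> Mor D (rk X) (rk Y)\<rbrakk>
      \<Longrightarrow> Dag E X Y (cl X Y f) = cl Y X (Dag D (rk X) (rk Y) f)"
begin

sublocale dagger_category E
proof
  fix X Y f assume o: "X \<in> Ob E" "Y \<in> Ob E" and f: "f \<in> Mor E X Y"
  obtain f' where "f' \<in> Mor D (rk X) (rk Y)" "f = cl X Y f'"
    using o f by (metis mor_cases)
  then show "Dag E X Y f \<in> Mor E Y X" "Dag E Y X (Dag E X Y f) = f"
    using o by (simp_all add: cl_dag cl_mor rk D.dag_mor D.dag_dag)
next
  fix X assume "X \<in> Ob E"
  then show "Dag E X X (Ident E X) = Ident E X"
    by (simp add: cl_ident cl_dag rk D.ident_mor D.dag_ident)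
next
  fix X Y Z f g
  assume o: "X \<in> Ob E" "Y \<in> Ob E" "Z \<in> Ob E" and f: "f \<in> Mor E X Y" and g: "g \<in> Mor E Y Z"
  obtain f' g' where "f' \<in> Mor D (rk X) (rk Y)" "f = cl X Y f'" "g' \<in> Mor D (rk Y) (rk Z)" "g = cl Y Z g'"
    using o f g by (metis mor_cases)
  then show "Dag E X Z (Comp E X Y Z g f) = Comp E Z Y X (Dag E X Y f) (Dag E Y Z g)"
    using o by (simp add: cl_comp cl_dag rk D.comp_mor D.dag_mor D.dag_comp)
qed

theorem dagger_equivalent: "dagger_equivalent E D"
proof -
  interpret F: is_functor E D coord_functor by (rule coord_functor)
  interpret G: is_functor D E standard_functor by (rule standard_functor)
  have "dagger_functor E D coord_functor"
  proof
    fix X Y f assume o: "X \<in> Ob E" "Y \<in> Ob E" and f: "f \<in> Mor E X Y"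
    obtain f' where "f' \<in> Mor D (rk X) (rk Y)" "f = cl X Y f'"
      using o f by (metis mor_cases)
    then show "FMor coord_functor Y X (Dag E X Y f)
        = Dag D (FOb coord_functor X) (FOb coord_functor Y) (FMor coord_functor X Y f)"
      using o by (simp add: coord_functor_def cl_dag coord_cl rk D.dag_mor)
  qed
  moreover have "dagger_functor D E standard_functor"
    by unfold_locales (simp add: standard_functor_def cl_dag st rk_st)
  moreover have "unitary E (FOb (comp_functor standard_functor coord_functor) X) X (unit_component X)"
    if "X \<in> Ob E" for X
  proof -
    have "Dag E (st (rk X)) X (unit_component X) = cl X (st (rk X)) (Ident D (rk X))"
      using that by (simp add: unit_component_def cl_dag st rk rk_st D.ident_mor D.dag_ident)
    then show ?thesis
      using unit_inverses[OF that]
      by (simp add: unitary_def comp_functor_def standard_functor_def coord_functor_def)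
  qed
  moreover have "unitary D (FOb (comp_functor coord_functor standard_functor) n) n (Ident D n)"
    if "n \<in> Ob D" for n
    using that by (simp add: unitary_def comp_functor_def standard_functor_def coord_functor_def
        rk_st D.dag_ident inverses_Ident)
  ultimately show ?thesis
    unfolding dagger_equivalent_def using unit_natural_iso counit_natural_iso by blast
qed

end

section \<open>Quadratic forms\<close>

lemma scalar_prod_self_nonneg: "0 \<le> v \<bullet> (v :: real vec)"
  by (simp add: scalar_prod_def sum_nonneg)

lemma scalar_prod_self_eq_0:
  assumes "v \<in> carrier_vec n"
  shows "v \<bullet> (v :: real vec) = 0 \<longleftrightarrow> v = 0\<^sub>v n"
proof
  assume "v \<bullet> v = 0"
  then have "\<forall>i<n. v $ i = 0"
    using assms by (auto simp: scalar_prod_def sum_nonneg_eq_0_iff)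
  then show "v = 0\<^sub>v n" using assms by (intro eq_vecI) auto
qed (use assms in simp)

lemma gram_quadratic_form:
  fixes L :: "real mat"
  assumes "L \<in> carrier_mat n r" "x \<in> carrier_vec n"
  shows "x \<bullet> ((L * L\<^sup>T) *\<^sub>v x) = (L\<^sup>T *\<^sub>v x) \<bullet> (L\<^sup>T *\<^sub>v x)"
proof -
  have "(L\<^sup>T *\<^sub>v x) \<bullet> (L\<^sup>T *\<^sub>v x) = x \<bullet> (L *\<^sub>v (L\<^sup>T *\<^sub>v x))"
    using assms by (intro transpose_vec_mult_scalar[of L n r]) (auto intro: mult_mat_vec_carrier)
  then show ?thesis using assms by (simp add: assoc_mult_mat_vec[of L n r "L\<^sup>T" n])
qed

lemma gram_positive_semidefinite:
  fixes L :: "real mat"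
  assumes "L \<in> carrier_mat n r"
  shows "positive_semidefinite (L * L\<^sup>T)"
  unfolding positive_semidefinite_def
proof (intro conjI ballI)
  show "(L * L\<^sup>T)\<^sup>T = L * L\<^sup>T"
    using assms by (simp add: transpose_mult[of L n r])
  fix x :: "real vec" assume "x \<in> carrier_vec (dim_row (L * L\<^sup>T))"
  then have "x \<in> carrier_vec n" using assms by simp
  from gram_quadratic_form[OF assms this] show "0 \<le> x \<bullet> ((L * L\<^sup>T) *\<^sub>v x)"
    by (simp add: scalar_prod_self_nonneg)
qed

text \<open>
  The diagonal entries of a Gram matrix are the squared lengths of the rows.
\<close>

lemma gram_eq_0:
  fixes L :: "real mat"
  assumes L: "L \<in> carrier_mat n r" and "\<And>i. i < n \<Longrightarrow> (L * L\<^sup>T) $$ (i, i) \<le> 0"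
  shows "L = 0\<^sub>m n r"
proof (rule eq_rowI)
  fix i assume "i < dim_row (0\<^sub>m n r :: real mat)"
  then have i: "i < n" by simp
  have "row L i \<bullet> row L i = (L * L\<^sup>T) $$ (i, i)"
    using L i by simp
  then have "row L i \<bullet> row L i = 0"
    using assms(2)[OF i] scalar_prod_self_nonneg[of "row L i"] by linarith
  then show "row L i = row (0\<^sub>m n r) i"
    using scalar_prod_self_eq_0[of "row L i" r] L i by simp
qed (use L in auto)

lemma unit_vec_quadratic_form:
  assumes "S \<in> carrier_mat n n" "i < n" "j < n"
  shows "unit_vec n i \<bullet> (S *\<^sub>v unit_vec n j) = (S $$ (i, j) :: real)"
  using assms by simp

lemma positive_semidefiniteD:
  assumes "positive_semidefinite S" "S \<in> carrier_mat n n" "x \<in> carrier_vec n"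
  shows "0 \<le> x \<bullet> (S *\<^sub>v x)"
  using assms by (simp add: positive_semidefinite_def)

lemma positive_definiteD:
  assumes "positive_definite S" "S \<in> carrier_mat n n" "x \<in> carrier_vec n" "x \<noteq> 0\<^sub>v n"
  shows "0 < x \<bullet> (S *\<^sub>v x)"
  using assms by (simp add: positive_definite_def)

text \<open>
  The quadratic form at \<open>t e\<^sub>i + e\<^sub>j\<close> is affine in \<open>t\<close> when the entry \<open>S\<^sub>i\<^sub>i\<close> vanishes, and a nonnegative
  affine function is constant. This is what makes elimination possible at a zero pivot.
\<close>

lemma positive_semidefinite_zero_diag:
  assumes S: "positive_semidefinite S" "S \<in> carrier_mat n n" and i: "i < n" and j: "j < n"
    and 0: "S $$ (i, i) = 0"
  shows "S $$ (j, i) = 0"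
proof (rule ccontr)
  assume nz: "S $$ (j, i) \<noteq> 0"
  have sym: "S $$ (i, j) = S $$ (j, i)"
  proof -
    have "S $$ (i, j) = S\<^sup>T $$ (j, i)" using S(2) i j by simp
    then show ?thesis using S(1) by (simp add: positive_semidefinite_def)
  qed
  have form: "0 \<le> 2 * t * S $$ (j, i) + S $$ (j, j)" for t
  proof -
    let ?x = "t \<cdot>\<^sub>v unit_vec n i + unit_vec n j"
    have "0 \<le> ?x \<bullet> (S *\<^sub>v ?x)"
      using S by (auto simp: positive_semidefinite_def)
    also have "S *\<^sub>v ?x = t \<cdot>\<^sub>v (S *\<^sub>v unit_vec n i) + S *\<^sub>v unit_vec n j"
      using S(2) by (simp add: mult_add_distrib_mat_vec[of _ n n] mult_mat_vec[of _ n n])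
    also have "?x \<bullet> (t \<cdot>\<^sub>v (S *\<^sub>v unit_vec n i) + S *\<^sub>v unit_vec n j)
      = t * (t * S $$ (i, i)) + t * S $$ (i, j) + (t * S $$ (j, i) + S $$ (j, j))"
      using S(2) i j
      by (simp add: add_scalar_prod_distrib[of _ n] scalar_prod_add_distrib[of _ n] mult_mat_vec_carrier[of _ n n]
          distrib_left)
    finally show ?thesis using 0 sym by simp
  qed
  \<comment> \<open>the parameter at which the affine function takes the value -1\<close>
  show False using form[of "- (S $$ (j, j) + 1) / (2 * S $$ (j, i))"] nz by (simp add: field_simps)
qed

lemma quadratic_form_congruence:
  fixes S :: "real mat"
  assumes S: "S \<in> carrier_mat n n" and A: "A \<in> carrier_mat m n" and x: "x \<in> carrier_vec m"
  shows "x \<bullet> ((A * S * A\<^sup>T) *\<^sub>v x) = (A\<^sup>T *\<^sub>v x) \<bullet> (S *\<^sub>v (A\<^sup>T *\<^sub>v x))"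
proof -
  have y: "A\<^sup>T *\<^sub>v x \<in> carrier_vec n" using A x by (auto intro: mult_mat_vec_carrier)
  have "(A * S * A\<^sup>T) *\<^sub>v x = (A * S) *\<^sub>v (A\<^sup>T *\<^sub>v x)"
    using A S x by (intro assoc_mult_mat_vec[of _ m n]) auto
  also have "\<dots> = A *\<^sub>v (S *\<^sub>v (A\<^sup>T *\<^sub>v x))"
    using A S y by (intro assoc_mult_mat_vec[of _ m n]) auto
  finally show ?thesis
    using transpose_vec_mult_scalar[OF A mult_mat_vec_carrier[OF S y] x] by simp
qed

lemma transpose_congruence:
  fixes S :: "real mat"
  assumes S: "S \<in> carrier_mat n n" "S\<^sup>T = S" and A: "A \<in> carrier_mat m n"
  shows "(A * S * A\<^sup>T)\<^sup>T = A * S * A\<^sup>T"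
proof -
  have "(A * S * A\<^sup>T)\<^sup>T = A\<^sup>T\<^sup>T * (A * S)\<^sup>T"
    using S A by (intro transpose_mult[of _ m n]) auto
  also have "(A * S)\<^sup>T = S * A\<^sup>T"
    using S A by (simp add: transpose_mult[of A m n S n])
  finally show ?thesis using S A by (simp add: assoc_mult_mat[of A m n S n "A\<^sup>T" m])
qed

lemma positive_semidefinite_congruence:
  assumes S: "positive_semidefinite S" "S \<in> carrier_mat n n" and A: "A \<in> carrier_mat m n"
  shows "positive_semidefinite (A * S * A\<^sup>T)"
  unfolding positive_semidefinite_def
proof (intro conjI ballI)
  show "(A * S * A\<^sup>T)\<^sup>T = A * S * A\<^sup>T"
    using S A by (intro transpose_congruence[of _ n]) (auto simp: positive_semidefinite_def)
  fix x :: "real vec" assume "x \<in> carrier_vec (dim_row (A * S * A\<^sup>T))"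
  then have x: "x \<in> carrier_vec m" using A by simp
  have "A\<^sup>T *\<^sub>v x \<in> carrier_vec n" using A x by (auto intro: mult_mat_vec_carrier)
  then show "0 \<le> x \<bullet> ((A * S * A\<^sup>T) *\<^sub>v x)"
    using S quadratic_form_congruence[OF S(2) A x] by (simp add: positive_semidefinite_def)
qed

text \<open>
  The right inverse of \<open>A\<close> makes \<open>A\<^sup>T\<close> injective, so nonzero vectors stay nonzero.
\<close>

lemma positive_definite_congruence:
  assumes S: "positive_definite S" "S \<in> carrier_mat n n" and A: "A \<in> carrier_mat m n"
    and B: "B \<in> carrier_mat n m" "A * B = 1\<^sub>m m"
  shows "positive_definite (A * S * A\<^sup>T)"
  unfolding positive_definite_def
proof (intro conjI ballI impI)
  show "(A * S * A\<^sup>T)\<^sup>T = A * S * A\<^sup>T"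
    using S A by (intro transpose_congruence[of _ n]) (auto simp: positive_definite_def)
  fix x :: "real vec" assume "x \<in> carrier_vec (dim_row (A * S * A\<^sup>T))" "x \<noteq> 0\<^sub>v (dim_row (A * S * A\<^sup>T))"
  then have x: "x \<in> carrier_vec m" "x \<noteq> 0\<^sub>v m" using A by simp_all
  have y: "A\<^sup>T *\<^sub>v x \<in> carrier_vec n" using A x by (auto intro: mult_mat_vec_carrier)
  have "B\<^sup>T *\<^sub>v (A\<^sup>T *\<^sub>v x) = (A * B)\<^sup>T *\<^sub>v x"
    unfolding transpose_mult[OF A B(1)] using A B x
    by (intro assoc_mult_mat_vec[symmetric]) auto
  then have "B\<^sup>T *\<^sub>v (A\<^sup>T *\<^sub>v x) = x" using B x by simp
  moreover have "B\<^sup>T *\<^sub>v 0\<^sub>v n = 0\<^sub>v m" using B by (intro eq_vecI) auto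
  ultimately have "A\<^sup>T *\<^sub>v x \<noteq> 0\<^sub>v n" using x by auto
  then show "0 < x \<bullet> ((A * S * A\<^sup>T) *\<^sub>v x)"
    using S y quadratic_form_congruence[OF S(2) A x(1)] by (simp add: positive_definite_def)
qed

lemma positive_semidefinite_add:
  assumes "positive_semidefinite S" "positive_semidefinite T" "S \<in> carrier_mat n n" "T \<in> carrier_mat n n"
  shows "positive_semidefinite (S + T)"
  using assms
  by (auto simp: positive_semidefinite_def transpose_add[of _ n n] add_mult_distrib_mat_vec[of _ n n]
      scalar_prod_add_distrib[of _ n] mult_mat_vec_carrier[of _ n n])

lemma positive_definite_imp_positive_semidefinite:
  assumes "positive_definite S"
  shows "positive_semidefinite S"
  using assms unfolding positive_definite_def positive_semidefinite_def
  by (metis carrier_matI index_transpose_mat(2) less_eq_real_def mult_mat_vec_carrier scalar_prod_left_zero)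

section \<open>Rank and Cholesky factorizations\<close>

text \<open>
  The left inverse \<open>K\<close> forces \<open>L\<close> to have independent columns, so that \<open>r\<close> is the rank of \<open>S\<close>.
  Carrying \<open>K\<close> along lets all cancellation arguments be plain matrix identities.
\<close>

definition rank_factorization :: "nat \<Rightarrow> nat \<Rightarrow> real mat \<Rightarrow> real mat \<Rightarrow> real mat \<Rightarrow> bool" where
  "rank_factorization n r S L K \<longleftrightarrow>
     L \<in> carrier_mat n r \<and> K \<in> carrier_mat r n \<and> K * L = 1\<^sub>m r \<and> L * L\<^sup>T = S"

lemma rank_factorizationI:
  assumes "L \<in> carrier_mat n r" "K \<in> carrier_mat r n" "K * L = 1\<^sub>m r" "L * L\<^sup>T = S"
  shows "rank_factorization n r S L K"
  using assms by (simp add: rank_factorization_def)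

lemma rank_factorizationD:
  assumes "rank_factorization n r S L K"
  shows "L \<in> carrier_mat n r" "K \<in> carrier_mat r n" "K * L = 1\<^sub>m r" "L * L\<^sup>T = S"
  using assms by (simp_all add: rank_factorization_def)

lemma four_block_mat_product:
  assumes "A1 \<in> carrier_mat nr1 n1" "B1 \<in> carrier_mat nr1 n2" "C1 \<in> carrier_mat nr2 n1" "D1 \<in> carrier_mat nr2 n2"
    and "A2 \<in> carrier_mat n1 nc1" "B2 \<in> carrier_mat n1 nc2" "C2 \<in> carrier_mat n2 nc1" "D2 \<in> carrier_mat n2 nc2"
    and "A1 * A2 + B1 * C2 = A" "A1 * B2 + B1 * D2 = B" "C1 * A2 + D1 * C2 = C" "C1 * B2 + D1 * D2 = D"
  shows "four_block_mat A1 B1 C1 D1 * four_block_mat A2 B2 C2 D2 = four_block_mat A B C D"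
  using mult_four_block_mat[OF assms(1-8)] assms(9-12) by simp

lemma four_block_mat_empty_corner [simp]:
  fixes X :: "real mat"
  assumes "X \<in> carrier_mat n m"
  shows "four_block_mat (0\<^sub>m 0 0) (0\<^sub>m 0 m) (0\<^sub>m n 0) X = X"
  using assms by (intro eq_matI) auto

definition schur_complement :: "real \<Rightarrow> real mat \<Rightarrow> real mat \<Rightarrow> real mat" where
  "schur_complement a C D = D - (1 / a) \<cdot>\<^sub>m (C * C\<^sup>T)"

context
  fixes S C D :: "real mat" and a :: real and p n :: nat
  assumes C: "C \<in> carrier_mat n p" and D: "D \<in> carrier_mat n n"
    and S: "S = four_block_mat (a \<cdot>\<^sub>m 1\<^sub>m p) C\<^sup>T C D"
begin

lemma schur_complement_carrier: "schur_complement a C D \<in> carrier_mat n n"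
  using C D by (auto simp: schur_complement_def)

text \<open>
  One step of block elimination. Being of the form \<open>P S P\<^sup>T\<close>, the Schur complement inherits positive
  semidefiniteness from \<open>S\<close>, and positive definiteness because \<open>P\<close> has a right inverse. For
  \<open>a = 0\<close> the convention \<open>1 / 0 = 0\<close> makes the complement equal to \<open>D\<close>, as it should be.
\<close>

lemma schur_complement_congruence:
  assumes "a = 0 \<Longrightarrow> C = 0\<^sub>m n p"
  obtains P Q where "P \<in> carrier_mat n (p + n)" "Q \<in> carrier_mat (p + n) n" "P * Q = 1\<^sub>m n"
    "P * S * P\<^sup>T = schur_complement a C D"
proof
  define E where "E = - (1 / a) \<cdot>\<^sub>m C"
  have E: "E \<in> carrier_mat n p" using C by (simp add: E_def)
  let ?P = "four_block_mat (0\<^sub>m 0 p) (0\<^sub>m 0 n) E (1\<^sub>m n)"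
  let ?Q = "four_block_mat (0\<^sub>m p 0) (0\<^sub>m p n) (0\<^sub>m n 0) (1\<^sub>m n)"
  have P: "?P \<in> carrier_mat (0 + n) (p + n)" using E by (intro four_block_carrier_mat) auto
  then show "?P \<in> carrier_mat n (p + n)" by simp
  have Q: "?Q \<in> carrier_mat (p + n) (0 + n)" by (intro four_block_carrier_mat) auto
  then show "?Q \<in> carrier_mat (p + n) n" by simp
  have "?P * ?Q = four_block_mat (0\<^sub>m 0 0) (0\<^sub>m 0 n) (0\<^sub>m n 0) (1\<^sub>m n)"
    by (rule four_block_mat_product[of _ 0 p _ n _ n _ _ 0 _ n]) (use E in auto)
  then show "?P * ?Q = 1\<^sub>m n" by simp
  have EA: "E * (a \<cdot>\<^sub>m 1\<^sub>m p) + 1\<^sub>m n * C = 0\<^sub>m n p"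
  proof -
    have "E * (a \<cdot>\<^sub>m 1\<^sub>m p) = a \<cdot>\<^sub>m E" using E by (simp add: mult_smult_distrib[of _ n p _ p])
    also have "a \<cdot>\<^sub>m E + 1\<^sub>m n * C = 0\<^sub>m n p"
      using C assms by (intro eq_matI; cases "a = 0") (auto simp: E_def)
    finally show ?thesis .
  qed
  have EC: "E * C\<^sup>T + 1\<^sub>m n * D = schur_complement a C D"
    using C D by (intro eq_matI) (auto simp: schur_complement_def E_def)
  have PS: "?P * S = four_block_mat (0\<^sub>m 0 p) (0\<^sub>m 0 n) (0\<^sub>m n p) (schur_complement a C D)"
    unfolding S by (rule four_block_mat_product[of _ 0 p _ n _ n _ _ p _ n])
      (use C D E EA EC in auto)
  have PT: "?P\<^sup>T = four_block_mat (0\<^sub>m p 0) E\<^sup>T (0\<^sub>m n 0) (1\<^sub>m n)"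
    using E by (simp add: transpose_four_block_mat[of _ 0 p _ n _ n])
  have "?P * S * ?P\<^sup>T = four_block_mat (0\<^sub>m 0 0) (0\<^sub>m 0 n) (0\<^sub>m n 0) (schur_complement a C D)"
    unfolding PS PT by (rule four_block_mat_product[of _ 0 p _ n _ n _ _ 0 _ n])
      (use C D E schur_complement_carrier in auto)
  then show "?P * S * ?P\<^sup>T = schur_complement a C D"
    using schur_complement_carrier by simp
qed

lemma rank_factorization_pivot:
  assumes "0 < a" and "rank_factorization n r (schur_complement a C D) L K"
  shows "rank_factorization (p + n) (p + r) S
    (four_block_mat (sqrt a \<cdot>\<^sub>m 1\<^sub>m p) (0\<^sub>m p r) ((1 / sqrt a) \<cdot>\<^sub>m C) L)
    (four_block_mat ((1 / sqrt a) \<cdot>\<^sub>m 1\<^sub>m p) (0\<^sub>m p n) (- (1 / a) \<cdot>\<^sub>m (K * C)) K)"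
proof -
  have L: "L \<in> carrier_mat n r" and K: "K \<in> carrier_mat r n" and KL: "K * L = 1\<^sub>m r"
    and LL: "L * L\<^sup>T = schur_complement a C D"
    using assms(2) by (auto simp: rank_factorization_def)
  define s where "s = sqrt a"
  define t where "t = 1 / s"
  have "s * s = a" "s \<noteq> 0" using \<open>0 < a\<close> by (auto simp: s_def)
  then have st: "s * t = 1" "t * s = 1" "s * s = a" "1 / a = t * t" by (auto simp: t_def field_simps)
  let ?L = "four_block_mat (s \<cdot>\<^sub>m 1\<^sub>m p) (0\<^sub>m p r) (t \<cdot>\<^sub>m C) L"
  let ?K = "four_block_mat (t \<cdot>\<^sub>m 1\<^sub>m p) (0\<^sub>m p n) (- (t * t) \<cdot>\<^sub>m (K * C)) K"
  have KC: "K * C \<in> carrier_mat r p" using K C by simp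
  have "rank_factorization (p + n) (p + r) S ?L ?K"
  proof (rule rank_factorizationI)
    show "?L \<in> carrier_mat (p + n) (p + r)" using L by (intro four_block_carrier_mat) auto
    show "?K \<in> carrier_mat (p + r) (p + n)" using K by (intro four_block_carrier_mat) auto
    have 21: "(- (t * t) \<cdot>\<^sub>m (K * C)) * (s \<cdot>\<^sub>m 1\<^sub>m p) + K * (t \<cdot>\<^sub>m C) = 0\<^sub>m r p"
    proof -
      have "(- (t * t) \<cdot>\<^sub>m (K * C)) * (s \<cdot>\<^sub>m 1\<^sub>m p) = s \<cdot>\<^sub>m (- (t * t) \<cdot>\<^sub>m (K * C))"
        using smult_carrier_mat[OF KC]
        by (simp add: mult_smult_distrib[of _ r p _ p] right_mult_one_mat[of _ r p])
      moreover have "K * (t \<cdot>\<^sub>m C) = t \<cdot>\<^sub>m (K * C)"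
        using K C by (simp add: mult_smult_distrib[of _ r n _ p])
      moreover have "s \<cdot>\<^sub>m (- (t * t) \<cdot>\<^sub>m M) + t \<cdot>\<^sub>m M = 0\<^sub>m r p" if "M \<in> carrier_mat r p" for M
        using that st(1) by (intro eq_matI) (auto simp flip: mult.assoc)
      ultimately show ?thesis using KC by simp
    qed
    have 11: "(t \<cdot>\<^sub>m 1\<^sub>m p) * (s \<cdot>\<^sub>m 1\<^sub>m p) = 1\<^sub>m p"
      using st by (intro eq_matI) (auto simp: mult_smult_distrib[of _ p p _ p])
    have "?K * ?L = four_block_mat (1\<^sub>m p) (0\<^sub>m p r) (0\<^sub>m r p) (1\<^sub>m r)"
      by (rule four_block_mat_product[of _ p p _ n _ r _ _ p _ r])
        (use L K C KC KL in \<open>auto simp: 11 21\<close>)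
    then show "?K * ?L = 1\<^sub>m (p + r)" by simp
    have LT: "?L\<^sup>T = four_block_mat (s \<cdot>\<^sub>m 1\<^sub>m p) (t \<cdot>\<^sub>m C\<^sup>T) (0\<^sub>m r p) L\<^sup>T"
    proof -
      have "(s \<cdot>\<^sub>m 1\<^sub>m p)\<^sup>T = s \<cdot>\<^sub>m 1\<^sub>m p" "(t \<cdot>\<^sub>m C)\<^sup>T = t \<cdot>\<^sub>m C\<^sup>T" by (auto intro!: eq_matI)
      then show ?thesis using L C by (simp add: transpose_four_block_mat[of _ p p _ r _ n])
    qed
    have b11: "(s \<cdot>\<^sub>m 1\<^sub>m p) * (s \<cdot>\<^sub>m 1\<^sub>m p) = a \<cdot>\<^sub>m 1\<^sub>m p"
      using st by (intro eq_matI) (auto simp: mult_smult_distrib[of _ p p _ p])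
    have b12: "(s \<cdot>\<^sub>m 1\<^sub>m p) * (t \<cdot>\<^sub>m C\<^sup>T) = C\<^sup>T"
    proof -
      have "(s \<cdot>\<^sub>m 1\<^sub>m p) * (t \<cdot>\<^sub>m C\<^sup>T) = s \<cdot>\<^sub>m (t \<cdot>\<^sub>m C\<^sup>T)"
        using C by (simp add: mult_smult_assoc_mat[of _ p p _ n])
      also have "\<dots> = C\<^sup>T" using st by (intro eq_matI) (auto simp flip: mult.assoc)
      finally show ?thesis .
    qed
    have b21: "(t \<cdot>\<^sub>m C) * (s \<cdot>\<^sub>m 1\<^sub>m p) = C"
    proof -
      have "(t \<cdot>\<^sub>m C) * (s \<cdot>\<^sub>m 1\<^sub>m p) = s \<cdot>\<^sub>m (t \<cdot>\<^sub>m C)"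
        using C by (simp add: mult_smult_distrib[of _ n p _ p])
      also have "\<dots> = C" using st by (intro eq_matI) (auto simp flip: mult.assoc)
      finally show ?thesis .
    qed
    have b22: "(t \<cdot>\<^sub>m C) * (t \<cdot>\<^sub>m C\<^sup>T) + L * L\<^sup>T = D"
    proof -
      have "(t \<cdot>\<^sub>m C) * (t \<cdot>\<^sub>m C\<^sup>T) = (t * t) \<cdot>\<^sub>m (C * C\<^sup>T)"
      proof -
        have "(t \<cdot>\<^sub>m C) * (t \<cdot>\<^sub>m C\<^sup>T) = t \<cdot>\<^sub>m (t \<cdot>\<^sub>m (C * C\<^sup>T))"
          using C by (simp add: mult_smult_distrib[of _ n p _ n] mult_smult_assoc_mat[of _ n p _ n])
        then show ?thesis by (auto intro!: eq_matI)
      qed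
      moreover have "(t * t) \<cdot>\<^sub>m (C * C\<^sup>T) + (D - (t * t) \<cdot>\<^sub>m (C * C\<^sup>T)) = D"
        using C D by (intro eq_matI) (auto simp del: index_mult_mat(1))
      ultimately show ?thesis by (simp add: LL schur_complement_def st(4))
    qed
    show "?L * ?L\<^sup>T = S"
      unfolding LT S
      by (rule four_block_mat_product[of _ p p _ r _ n _ _ p _ n])
        (use L C D b22 in \<open>auto simp: b11 b12 b21\<close>)
  qed
  then show ?thesis by (simp only: st(4) s_def[symmetric] t_def[symmetric])
qed

lemma rank_factorization_zero_pivot:
  assumes "a = 0" "C = 0\<^sub>m n p" and "rank_factorization n r D L K"
  shows "rank_factorization (p + n) r S
    (four_block_mat (0\<^sub>m p 0) (0\<^sub>m p r) (0\<^sub>m n 0) L)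
    (four_block_mat (0\<^sub>m 0 p) (0\<^sub>m 0 n) (0\<^sub>m r p) K)"
    (is "rank_factorization _ _ _ ?L ?K")
proof -
  have L: "L \<in> carrier_mat n r" and K: "K \<in> carrier_mat r n" and KL: "K * L = 1\<^sub>m r"
    and LL: "L * L\<^sup>T = D"
    using assms(3) by (auto simp: rank_factorization_def)
  show ?thesis
  proof (rule rank_factorizationI)
    have "?L \<in> carrier_mat (p + n) (0 + r)" using L by (intro four_block_carrier_mat) auto
    then show "?L \<in> carrier_mat (p + n) r" by simp
    have "?K \<in> carrier_mat (0 + r) (p + n)" using K by (intro four_block_carrier_mat) auto
    then show "?K \<in> carrier_mat r (p + n)" by simp
    have "?K * ?L = four_block_mat (0\<^sub>m 0 0) (0\<^sub>m 0 r) (0\<^sub>m r 0) (1\<^sub>m r)"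
      by (rule four_block_mat_product[of _ 0 p _ n _ r _ _ 0 _ r])
        (use L K KL in simp_all)
    then show "?K * ?L = 1\<^sub>m r" by simp
    have LT: "?L\<^sup>T = four_block_mat (0\<^sub>m 0 p) (0\<^sub>m 0 n) (0\<^sub>m r p) L\<^sup>T"
      using L by (simp add: transpose_four_block_mat[of _ p 0 _ r _ n])
    have "a \<cdot>\<^sub>m 1\<^sub>m p = 0\<^sub>m p p" using assms(1) by (intro eq_matI) auto
    then show "?L * ?L\<^sup>T = S"
      unfolding LT S
      by (intro four_block_mat_product[of _ p 0 _ r _ n _ _ p _ n])
        (use L LL D assms(1,2) in simp_all)
  qed
qed

end

text \<open>
  Induction on the size, splitting off the first row and column. A zero pivot leaves out a column
  of \<open>L\<close>; it cannot occur in the positive definite case, where the recursion is therefore the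
  Cholesky algorithm.
\<close>

lemma rank_factorization_exists:
  assumes "S \<in> carrier_mat n n" "positive_semidefinite S"
  shows "\<exists>r L K. rank_factorization n r S L K \<and> (positive_definite S \<longrightarrow> cholesky_factor n S L)"
  using assms
proof (induction n arbitrary: S)
  case 0
  have "rank_factorization 0 0 S (0\<^sub>m 0 0) (0\<^sub>m 0 0)"
    using 0 by (intro rank_factorizationI) auto
  moreover have "cholesky_factor 0 S (0\<^sub>m 0 0)"
    using 0 by (auto simp: cholesky_factor_def)
  ultimately show ?case by blast
next
  case (Suc n)
  note carS = Suc.prems(1) and psd = Suc.prems(2)
  obtain A B C D where split: "split_block S 1 1 = (A, B, C, D)" by (cases "split_block S 1 1") auto
  note blocks = split_block[OF split, of n n]
  have A: "A \<in> carrier_mat 1 1" and B: "B \<in> carrier_mat 1 n" and C: "C \<in> carrier_mat n 1"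
    and D: "D \<in> carrier_mat n n" and eq: "S = four_block_mat A B C D"
    using blocks carS by auto
  define a where "a = S $$ (0, 0)"
  have A_eq: "A = a \<cdot>\<^sub>m 1\<^sub>m 1" using A B C D by (intro eq_matI) (auto simp: a_def eq)
  have B_eq: "B = C\<^sup>T"
  proof (rule eq_matI)
    fix i j assume "i < dim_row C\<^sup>T" "j < dim_col C\<^sup>T"
    then have ij: "i = 0" "j < n" using C by auto
    have "S $$ (0, Suc j) = S\<^sup>T $$ (0, Suc j)" using psd by (simp add: positive_semidefinite_def)
    then have "S $$ (0, Suc j) = S $$ (Suc j, 0)" using carS ij by simp
    then show "B $$ (i, j) = C\<^sup>T $$ (i, j)" using A B C D ij by (simp add: eq)
  qed (use B C in auto)
  have S: "S = four_block_mat (a \<cdot>\<^sub>m 1\<^sub>m 1) C\<^sup>T C D" using eq A_eq B_eq by simp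
  have a0: "0 \<le> a"
  proof -
    have "0 \<le> unit_vec (Suc n) 0 \<bullet> (S *\<^sub>v unit_vec (Suc n) 0)"
      by (rule positive_semidefiniteD[OF psd carS]) simp
    then show ?thesis using unit_vec_quadratic_form[OF carS, of 0 0] by (simp add: a_def)
  qed
  have C0: "C = 0\<^sub>m n 1" if "a = 0"
  proof (rule eq_matI)
    fix i j assume "i < dim_row (0\<^sub>m n 1 :: real mat)" "j < dim_col (0\<^sub>m n 1 :: real mat)"
    then have ij: "i < n" "j = 0" by auto
    have "S $$ (Suc i, 0) = 0"
      using positive_semidefinite_zero_diag[OF psd carS, of 0 "Suc i"] that ij by (simp add: a_def)
    then show "C $$ (i, j) = 0\<^sub>m n 1 $$ (i, j)" using A B C D ij by (simp add: eq)
  qed (use C in auto)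
  let ?T = "schur_complement a C D"
  obtain P Q where PQ: "P \<in> carrier_mat n (1 + n)" "Q \<in> carrier_mat (1 + n) n" "P * Q = 1\<^sub>m n"
    "P * S * P\<^sup>T = ?T"
    using schur_complement_congruence[OF C D S] C0 by blast
  have T: "?T \<in> carrier_mat n n" using schur_complement_carrier[OF C D S] .
  have "positive_semidefinite ?T"
    using positive_semidefinite_congruence[OF psd carS, of P n] PQ by simp
  then obtain r L K where LK: "rank_factorization n r ?T L K"
    and chol: "positive_definite ?T \<longrightarrow> cholesky_factor n ?T L"
    using Suc.IH[OF T] by blast
  have T_pd: "positive_definite ?T" if "positive_definite S"
    using positive_definite_congruence[OF that carS, of P n Q] PQ by simp
  show ?case
  proof (cases "a = 0")
    case True
    have "?T = D" unfolding schur_complement_def C0[OF True] using True D by (intro eq_matI) auto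
    with LK have "\<exists>r L K. rank_factorization (1 + n) r S L K"
      using rank_factorization_zero_pivot[OF C D S True C0[OF True]] by metis
    moreover have "\<not> positive_definite S"
    proof
      assume "positive_definite S"
      then have "0 < unit_vec (Suc n) 0 \<bullet> (S *\<^sub>v unit_vec (Suc n) 0)"
        by (rule positive_definiteD[OF _ carS]) simp_all
      then show False using unit_vec_quadratic_form[OF carS, of 0 0] True by (simp add: a_def)
    qed
    ultimately show ?thesis by simp
  next
    case False
    then have a: "0 < a" using a0 by simp
    define L' where "L' = four_block_mat (sqrt a \<cdot>\<^sub>m 1\<^sub>m 1) (0\<^sub>m 1 r) ((1 / sqrt a) \<cdot>\<^sub>m C) L"
    obtain K' where L'K': "rank_factorization (1 + n) (1 + r) S L' K'"
      using rank_factorization_pivot[OF C D S a LK] unfolding L'_def by blast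
    have "cholesky_factor (Suc n) S L'" if "positive_definite S"
    proof -
      have r: "r = n"
        using chol T_pd[OF that] LK by (auto simp: cholesky_factor_def rank_factorization_def)
      have L: "L \<in> carrier_mat n n" "upper_triangular L\<^sup>T" "\<forall>i<n. 0 < L $$ (i, i)"
        using chol T_pd[OF that] by (auto simp: cholesky_factor_def)
      have carL': "L' \<in> carrier_mat (Suc n) (Suc n)" using L r by (auto simp: L'_def)
      have "0 < L' $$ (i, i)" if "i < Suc n" for i
        using that L a by (cases i) (auto simp: L'_def)
      moreover have "L'\<^sup>T $$ (i, j) = 0" if "i < Suc n" "j < i" for i j
      proof (cases j)
        case 0
        then show ?thesis using that L C r by (auto simp: L'_def)
      next
        case (Suc k)
        then obtain l where l: "i = Suc l" "k < l" "l < n" using \<open>j < i\<close> \<open>i < Suc n\<close> by (cases i) auto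
        have "L\<^sup>T $$ (l, k) = 0" using L(1,2) l by (auto simp: upper_triangular_def)
        then show ?thesis using Suc l L(1) by (auto simp: L'_def)
      qed
      ultimately show ?thesis
        using L'K' carL' by (auto simp: cholesky_factor_def rank_factorization_def upper_triangular_def)
    qed
    then show ?thesis using L'K' by auto
  qed
qed

section \<open>Contractions and pushforwards of covariance matrices\<close>

lemma congruence_gram:
  fixes A L :: "real mat"
  assumes A: "A \<in> carrier_mat n m" and L: "L \<in> carrier_mat m r"
  shows "A * (L * L\<^sup>T) * A\<^sup>T = (A * L) * (A * L)\<^sup>T"
proof -
  have "(A * L) * (A * L)\<^sup>T = (A * L) * (L\<^sup>T * A\<^sup>T)" using A L by (simp add: transpose_mult)
  also have "\<dots> = (A * L) * L\<^sup>T * A\<^sup>T" using A L by (intro assoc_mult_mat[symmetric]) auto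
  also have "(A * L) * L\<^sup>T = A * (L * L\<^sup>T)" using A L by (intro assoc_mult_mat) auto
  finally show ?thesis by simp
qed

lemma congruence_add:
  fixes P S T :: "real mat"
  assumes "P \<in> carrier_mat n m" "S \<in> carrier_mat m m" "T \<in> carrier_mat m m"
  shows "P * (S + T) * P\<^sup>T = P * S * P\<^sup>T + P * T * P\<^sup>T"
  using assms
  by (simp add: mult_add_distrib_mat[of _ n m _ m] add_mult_distrib_mat[of _ n m _ _ n])

lemma congruence_assoc:
  fixes A B S :: "real mat"
  assumes A: "A \<in> carrier_mat n m" and B: "B \<in> carrier_mat m k" and S: "S \<in> carrier_mat k k"
  shows "A * (B * S * B\<^sup>T) * A\<^sup>T = (A * B) * S * (A * B)\<^sup>T"
proof -
  have "(A * B) * S * (A * B)\<^sup>T = (A * B) * S * (B\<^sup>T * A\<^sup>T)" using A B by (simp add: transpose_mult)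
  also have "\<dots> = (A * B) * S * B\<^sup>T * A\<^sup>T" using A B S by (intro assoc_mult_mat[symmetric]) auto
  also have "(A * B) * S * B\<^sup>T = A * (B * S) * B\<^sup>T" using A B S by (simp add: assoc_mult_mat[of A n m B k S k])
  also have "\<dots> = A * (B * S * B\<^sup>T)" using A B S by (intro assoc_mult_mat) auto
  finally show ?thesis by simp
qed

lemma contraction_iff:
  assumes "M \<in> carrier_mat n m"
  shows "contraction M \<longleftrightarrow> (\<forall>x\<in>carrier_vec m. (M *\<^sub>v x) \<bullet> (M *\<^sub>v x) \<le> x \<bullet> x)"
  using assms by (simp add: contraction_def euclidean_norm_def)

text \<open>
  With \<open>y = M\<^sup>T x\<close> one has \<open>y \<bullet> y = x \<bullet> M y\<close> and \<open>M y \<bullet> M y \<le> y \<bullet> y\<close>, so expanding the square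
  \<open>0 \<le> |x - M y|\<^sup>2\<close> gives \<open>y \<bullet> y \<le> x \<bullet> x\<close>.
\<close>

lemma contraction_transpose:
  assumes M: "M \<in> carrier_mat n m" and c: "contraction M"
  shows "contraction M\<^sup>T"
proof -
  have "(M\<^sup>T *\<^sub>v x) \<bullet> (M\<^sup>T *\<^sub>v x) \<le> x \<bullet> x" if x: "x \<in> carrier_vec n" for x
  proof -
    define y where "y = M\<^sup>T *\<^sub>v x"
    have y: "y \<in> carrier_vec m" using M x by (auto simp: y_def intro: mult_mat_vec_carrier)
    have z: "M *\<^sub>v y \<in> carrier_vec n" using M y by (auto intro: mult_mat_vec_carrier)
    have "y \<bullet> y = x \<bullet> (M *\<^sub>v y)"
      using transpose_vec_mult_scalar[OF M y x] by (simp add: y_def)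
    moreover have "(M *\<^sub>v y) \<bullet> (M *\<^sub>v y) \<le> y \<bullet> y" using c y contraction_iff[OF M] by blast
    moreover have "(x - M *\<^sub>v y) \<bullet> (x - M *\<^sub>v y) = x \<bullet> x - 2 * (x \<bullet> (M *\<^sub>v y)) + (M *\<^sub>v y) \<bullet> (M *\<^sub>v y)"
      using x z comm_scalar_prod[OF z x]
      by (simp add: minus_scalar_prod_distrib[of _ n] scalar_prod_minus_distrib[of _ n])
    ultimately show ?thesis
      using scalar_prod_self_nonneg[of "x - M *\<^sub>v y"] by (simp add: y_def)
  qed
  then show ?thesis using contraction_iff[of "M\<^sup>T" m n] M by simp
qed

text \<open>
  The quadratic form of \<open>I - M M\<^sup>T\<close> at \<open>x\<close> is \<open>|x|\<^sup>2 - |M\<^sup>T x|\<^sup>2\<close>.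
\<close>

lemma contraction_iff_psd:
  assumes M: "M \<in> carrier_mat n m"
  shows "contraction M \<longleftrightarrow> positive_semidefinite (1\<^sub>m n - M * M\<^sup>T)"
proof -
  have "x \<bullet> ((1\<^sub>m n - M * M\<^sup>T) *\<^sub>v x) = x \<bullet> x - (M\<^sup>T *\<^sub>v x) \<bullet> (M\<^sup>T *\<^sub>v x)"
    if x: "x \<in> carrier_vec n" for x
  proof -
    have MM: "M * M\<^sup>T \<in> carrier_mat n n" using M by simp
    have "(1\<^sub>m n - M * M\<^sup>T) *\<^sub>v x = x - (M * M\<^sup>T) *\<^sub>v x"
      using MM x by (simp add: minus_mult_distrib_mat_vec[of _ n n])
    then show ?thesis
      using x mult_mat_vec_carrier[OF MM x] gram_quadratic_form[OF M x]
      by (simp add: scalar_prod_minus_distrib[of _ n] del: assoc_mult_mat_vec)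
  qed
  moreover have "(1\<^sub>m n - M * M\<^sup>T)\<^sup>T = 1\<^sub>m n - M * M\<^sup>T"
    using M by (simp add: transpose_minus[of _ n n] transpose_mult[of M n m])
  ultimately have "positive_semidefinite (1\<^sub>m n - M * M\<^sup>T) \<longleftrightarrow> contraction M\<^sup>T"
    using M contraction_iff[of "M\<^sup>T" m n] by (simp add: positive_semidefinite_def)
  moreover have "contraction M\<^sup>T \<longleftrightarrow> contraction M"
    using contraction_transpose[OF M] contraction_transpose[of "M\<^sup>T" m n] M by auto
  ultimately show ?thesis by simp
qed

lemma coisometry_contraction:
  assumes "M \<in> carrier_mat n m" "M * M\<^sup>T = 1\<^sub>m n"
  shows "contraction M"
proof -
  have "1\<^sub>m n - M * M\<^sup>T = 0\<^sub>m n n" using assms by simp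
  then show ?thesis
    unfolding contraction_iff_psd[OF assms(1)]
    using gram_positive_semidefinite[of "0\<^sub>m n n" n n] by simp
qed

lemma rank_factorization_right_cancel:
  assumes f: "rank_factorization n r S L K" and M: "M \<in> carrier_mat m r" "N \<in> carrier_mat m r"
  shows "M * L\<^sup>T = N * L\<^sup>T \<longleftrightarrow> M = N"
proof
  note L = rank_factorizationD[OF f]
  have "L\<^sup>T * K\<^sup>T = 1\<^sub>m r"
    using transpose_mult[OF L(2,1)] L(3) by simp
  moreover have "X * L\<^sup>T * K\<^sup>T = X * (L\<^sup>T * K\<^sup>T)" if "X \<in> carrier_mat m r" for X
    using L(1,2) that by (intro assoc_mult_mat) auto
  ultimately have "X * L\<^sup>T * K\<^sup>T = X" if "X \<in> carrier_mat m r" for X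
    using that by simp
  then show "M * L\<^sup>T = N * L\<^sup>T \<Longrightarrow> M = N" using M by metis
qed simp

lemma rank_factorization_mult_cancel:
  assumes f: "rank_factorization n r S L K" and A: "A \<in> carrier_mat m n" and B: "B \<in> carrier_mat m n"
  shows "A * S = B * S \<longleftrightarrow> A * L = B * L"
proof -
  note L = rank_factorizationD[OF f]
  have "X * S = X * L * L\<^sup>T" if "X \<in> carrier_mat m n" for X
    using assoc_mult_mat[OF that L(1), of "L\<^sup>T" n] L(1,4) by simp
  then show ?thesis
    using rank_factorization_right_cancel[OF f, of "A * L" m "B * L"] A B L(1) by simp
qed

lemma rank_factorization_left_cancel:
  assumes f: "rank_factorization n r S L K" and M: "M \<in> carrier_mat r m" "N \<in> carrier_mat r m"
    and eq: "L * M = L * N"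
  shows "M = N"
proof -
  note L = rank_factorizationD[OF f]
  have "K * (L * X) = X" if "X \<in> carrier_mat r m" for X
    using assoc_mult_mat[OF L(2,1) that] L(3) left_mult_one_mat[OF that] by simp
  then show ?thesis using M eq by metis
qed

lemma rank_factorization_whiten:
  assumes f: "rank_factorization n r S L K" 
  shows "K * S * K\<^sup>T = 1\<^sub>m r"
  using congruence_gram[OF rank_factorizationD(2)[OF f] rank_factorizationD(1)[OF f]]
  unfolding rank_factorizationD(3,4)[OF f] by simp

text \<open>
  The key step. The matrix \<open>P = I - L K\<close> annihilates \<open>L\<close>, hence \<open>P T P\<^sup>T = 0\<close>. This is the sum of
  the positive semidefinite matrices \<open>P S P\<^sup>T\<close> and \<open>(P R) (P R)\<^sup>T\<close>, so the diagonal of the second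
  one vanishes and \<open>P R = 0\<close>. Conjugating \<open>T\<close> by \<open>K\<close> instead turns it into the identity, and
  \<open>I - (K R) (K R)\<^sup>T = K S K\<^sup>T\<close> is positive semidefinite.
\<close>

lemma pushforward_coordinates:
  assumes f: "rank_factorization n l T L K" and R: "R \<in> carrier_mat n r"
    and S: "S \<in> carrier_mat n n" "positive_semidefinite S" and T: "T = S + R * R\<^sup>T"
  shows "R = L * (K * R)" "contraction (K * R)"
proof -
  note L = rank_factorizationD[OF f]
  have RR: "R * R\<^sup>T \<in> carrier_mat n n" using R by simp
  have KR: "K * R \<in> carrier_mat l r" using L(2) R by simp
  let ?P = "1\<^sub>m n - L * K"
  have LK: "L * K \<in> carrier_mat n n" using L(1,2) by simp
  have P: "?P \<in> carrier_mat n n" using LK by (rule minus_carrier_mat)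
  have "?P * L = 0\<^sub>m n l"
  proof -
    have "?P * L = L - (L * K) * L" using L(1) LK by (simp add: minus_mult_distrib_mat[of _ n n _ _ l])
    also have "(L * K) * L = L"
      using assoc_mult_mat[OF L(1,2,1)] L(3) right_mult_one_mat[OF L(1)] by simp
    finally show ?thesis using L(1) by simp
  qed
  then have "?P * T * ?P\<^sup>T = 0\<^sub>m n n"
    using congruence_gram[OF P L(1)] unfolding L(4) by simp
  moreover have "?P * T * ?P\<^sup>T = ?P * S * ?P\<^sup>T + (?P * R) * (?P * R)\<^sup>T"
    unfolding T congruence_add[OF P S(1) RR] congruence_gram[OF P R] ..
  ultimately have eq: "?P * S * ?P\<^sup>T + (?P * R) * (?P * R)\<^sup>T = 0\<^sub>m n n" by simp
  have PR: "?P * R \<in> carrier_mat n r" using P R by auto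
  have "?P * R = 0\<^sub>m n r"
  proof (rule gram_eq_0[OF PR])
    fix i assume i: "i < n"
    have "positive_semidefinite (?P * S * ?P\<^sup>T)"
      by (rule positive_semidefinite_congruence[OF S(2,1) P])
    moreover have "?P * S * ?P\<^sup>T \<in> carrier_mat n n" using P S by auto
    ultimately have "0 \<le> (?P * S * ?P\<^sup>T) $$ (i, i)"
      using i positive_semidefiniteD[of _ n "unit_vec n i"] unit_vec_quadratic_form[of _ n i i] by fastforce
    moreover have "(?P * S * ?P\<^sup>T + (?P * R) * (?P * R)\<^sup>T) $$ (i, i)
        = (?P * S * ?P\<^sup>T) $$ (i, i) + ((?P * R) * (?P * R)\<^sup>T) $$ (i, i)"
      by (rule index_add_mat) (use i PR in auto)
    ultimately show "((?P * R) * (?P * R)\<^sup>T) $$ (i, i) \<le> 0" using eq i by simp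
  qed
  moreover have "?P * R = R - L * (K * R)"
    using R L(1,2) LK by (simp add: minus_mult_distrib_mat[of _ n n _ _ r] assoc_mult_mat[of L n l K n R r])
  ultimately have "R - L * (K * R) = 0\<^sub>m n r" by simp
  then have "R $$ (i, j) = (L * (K * R)) $$ (i, j)" if "i < n" "j < r" for i j
  proof -
    have "(R - L * (K * R)) $$ (i, j) = 0" using \<open>R - L * (K * R) = 0\<^sub>m n r\<close> that by simp
    moreover have "(R - L * (K * R)) $$ (i, j) = R $$ (i, j) - (L * (K * R)) $$ (i, j)"
      by (rule index_minus_mat) (use that L(1) KR in auto)
    ultimately show ?thesis by simp
  qed
  then show "R = L * (K * R)" using R L(1) KR by (intro eq_matI) auto
  have "1\<^sub>m l = K * S * K\<^sup>T + (K * R) * (K * R)\<^sup>T"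
    using rank_factorization_whiten[OF f]
    unfolding T congruence_add[OF L(2) S(1) RR] congruence_gram[OF L(2) R] by (rule sym)
  moreover have KS: "K * S * K\<^sup>T \<in> carrier_mat l l" and G: "(K * R) * (K * R)\<^sup>T \<in> carrier_mat l l"
    using L(2) S(1) KR by auto
  moreover have "X + Y - Y = X" if "X \<in> carrier_mat l l" "Y \<in> carrier_mat l l" for X Y :: "real mat"
    using that by (intro eq_matI) auto
  ultimately have "1\<^sub>m l - (K * R) * (K * R)\<^sup>T = K * S * K\<^sup>T"
    by (metis (no_types))
  then show "contraction (K * R)"
    unfolding contraction_iff_psd[OF KR] using positive_semidefinite_congruence[OF S(2,1) L(2)] by simp
qed

section \<open>Joint distributions in the category of Gaussian kernels\<close>

lemma Gauss_sel [simp]: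
  "Ob Gauss = UNIV" "Unit Gauss = 0" "TenOb Gauss m n = m + n"
  "Ident Gauss n = (1\<^sub>m n, 0\<^sub>v n, 0\<^sub>m n n)"
  "Copy Gauss n = (1\<^sub>m n @\<^sub>r 1\<^sub>m n, 0\<^sub>v (n + n), 0\<^sub>m (n + n) (n + n))"
  "Comp Gauss k l j (A, b, S) (B, d, T) = (A * B, b + A *\<^sub>v d, S + A * T * A\<^sup>T)"
  "TenMor Gauss k l j i (A, b, S) (B, d, T) = (block_diag A B, b @\<^sub>v d, block_diag S T)"
  by (simp_all add: Gauss_def)

lemma Gauss_Mor:
  "(A, b, S) \<in> Mor Gauss m n \<longleftrightarrow> A \<in> carrier_mat n m \<and> b \<in> carrier_vec n \<and>
     S \<in> carrier_mat n n \<and> positive_semidefinite S"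
  by (simp add: Gauss_def)

lemma Gauss_state:
  "p \<in> Mor Gauss 0 n \<longleftrightarrow> (\<exists>b S. p = normal_state n b S \<and> b \<in> carrier_vec n \<and>
     S \<in> carrier_mat n n \<and> positive_semidefinite S)"
proof -
  have "A = 0\<^sub>m n 0" if "A \<in> carrier_mat n 0" for A :: "real mat"
    using that by (intro eq_matI) auto
  then show ?thesis
    by (cases p) (auto simp: Gauss_Mor normal_state_def)
qed

lemma normal_state_eq_iff [simp]:
  "normal_state n b S = normal_state n c T \<longleftrightarrow> b = c \<and> S = T"
  by (simp add: normal_state_def)

lemma Comp_normal_state:
  assumes "A \<in> carrier_mat n m"
  shows "Comp Gauss 0 m n (A, b, S) (normal_state m \<mu> \<Sigma>)
    = normal_state n (b + A *\<^sub>v \<mu>) (S + A * \<Sigma> * A\<^sup>T)"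
proof -
  have "A * 0\<^sub>m m 0 = 0\<^sub>m n 0" using assms by (intro eq_matI) auto
  then show ?thesis by (simp add: normal_state_def)
qed

lemma four_block_mat_eq_iff:
  assumes "A \<in> carrier_mat nr1 nc1" "B \<in> carrier_mat nr1 nc2" "C \<in> carrier_mat nr2 nc1" "D \<in> carrier_mat nr2 nc2"
    and "A' \<in> carrier_mat nr1 nc1" "B' \<in> carrier_mat nr1 nc2" "C' \<in> carrier_mat nr2 nc1" "D' \<in> carrier_mat nr2 nc2"
  shows "four_block_mat A B C D = four_block_mat A' B' C' D' \<longleftrightarrow> A = A' \<and> B = B' \<and> C = C' \<and> D = D'"
proof
  assume eq: "four_block_mat A B C D = four_block_mat A' B' C' D'"
  have ent: "four_block_mat A B C D $$ (i, j) = four_block_mat A' B' C' D' $$ (i, j)" for i j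
    using eq by simp
  have "A $$ (i, j) = A' $$ (i, j)" if "i < nr1" "j < nc1" for i j
    using ent[of i j] assms that by simp
  moreover have "B $$ (i, j) = B' $$ (i, j)" if "i < nr1" "j < nc2" for i j
    using ent[of i "nc1 + j"] assms that by simp
  moreover have "C $$ (i, j) = C' $$ (i, j)" if "i < nr2" "j < nc1" for i j
    using ent[of "nr1 + i" j] assms that by simp
  moreover have "D $$ (i, j) = D' $$ (i, j)" if "i < nr2" "j < nc2" for i j
    using ent[of "nr1 + i" "nc1 + j"] assms that by simp
  ultimately show "A = A' \<and> B = B' \<and> C = C' \<and> D = D'"
    using assms by (intro conjI eq_matI) auto
qed simp

text \<open>
  The covariance of two identical copies of a variable with covariance \<open>S\<close>. Here and below,
  stacked matrices are treated as block matrices with an empty second block column.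
\<close>

lemma copy_congruence:
  fixes S :: "real mat"
  assumes S: "S \<in> carrier_mat n n"
  shows "(1\<^sub>m n @\<^sub>r 1\<^sub>m n) * S * (1\<^sub>m n @\<^sub>r 1\<^sub>m n)\<^sup>T = four_block_mat S S S S"
proof -
  let ?Z = "0\<^sub>m n 0 :: real mat"
  have copy: "1\<^sub>m n @\<^sub>r 1\<^sub>m n = four_block_mat (1\<^sub>m n) ?Z (1\<^sub>m n) ?Z"
    by (simp add: append_rows_def)
  have S0: "S = four_block_mat S ?Z (0\<^sub>m 0 n) (0\<^sub>m 0 0)"
    using S by (intro eq_matI) auto
  have T: "(1\<^sub>m n @\<^sub>r 1\<^sub>m n)\<^sup>T = four_block_mat (1\<^sub>m n) (1\<^sub>m n) (0\<^sub>m 0 n) (0\<^sub>m 0 n :: real mat)"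
    unfolding copy by (simp add: transpose_four_block_mat[of _ n n _ 0 _ n])
  have "(1\<^sub>m n @\<^sub>r 1\<^sub>m n) * S = four_block_mat S ?Z S ?Z"
    unfolding copy by (subst S0, rule four_block_mat_product[of _ n n _ 0 _ n _ _ n _ 0]) (use S in simp_all)
  then show ?thesis
    unfolding T by (simp only:, intro four_block_mat_product[of _ n n _ 0 _ n _ _ n _ n]) (use S in simp_all)
qed

lemma Comp_Copy_normal_state:
  assumes "\<mu> \<in> carrier_vec n" "S \<in> carrier_mat n n"
  shows "Comp Gauss 0 n (n + n) (Copy Gauss n) (normal_state n \<mu> S)
    = normal_state (n + n) (\<mu> @\<^sub>v \<mu>) (four_block_mat S S S S)"
proof -
  have "1\<^sub>m n @\<^sub>r 1\<^sub>m n \<in> carrier_mat (n + n) n" by simp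
  then have "Comp Gauss 0 n (n + n) (Copy Gauss n) (normal_state n \<mu> S)
    = normal_state (n + n) (0\<^sub>v (n + n) + (1\<^sub>m n @\<^sub>r 1\<^sub>m n) *\<^sub>v \<mu>)
        (0\<^sub>m (n + n) (n + n) + (1\<^sub>m n @\<^sub>r 1\<^sub>m n) * S * (1\<^sub>m n @\<^sub>r 1\<^sub>m n)\<^sup>T)"
    unfolding Gauss_sel by (rule Comp_normal_state[unfolded Gauss_sel])
  also have "(1\<^sub>m n @\<^sub>r 1\<^sub>m n) *\<^sub>v \<mu> = \<mu> @\<^sub>v \<mu>"
    using assms(1) by (subst mat_mult_append[of _ n n _ n]) auto
  also have "0\<^sub>v (n + n) + (\<mu> @\<^sub>v \<mu>) = \<mu> @\<^sub>v \<mu>" using assms(1) by simp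
  also have "0\<^sub>m (n + n) (n + n) + (1\<^sub>m n @\<^sub>r 1\<^sub>m n) * S * (1\<^sub>m n @\<^sub>r 1\<^sub>m n)\<^sup>T = four_block_mat S S S S"
    unfolding copy_congruence[OF assms(2)] using assms(2) by simp
  finally show ?thesis .
qed

lemma block_diag_congruence:
  fixes A B S :: "real mat"
  assumes A: "A \<in> carrier_mat n m" and B: "B \<in> carrier_mat n' m" and S: "S \<in> carrier_mat m m"
  shows "block_diag A B * four_block_mat S S S S * (block_diag A B)\<^sup>T
    = four_block_mat (A * S * A\<^sup>T) (A * S * B\<^sup>T) (B * S * A\<^sup>T) (B * S * B\<^sup>T)"
proof -
  have d: "block_diag A B = four_block_mat A (0\<^sub>m n m) (0\<^sub>m n' m) B"
    using A B by (simp add: block_diag_def)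
  have T: "(block_diag A B)\<^sup>T = four_block_mat A\<^sup>T (0\<^sub>m m n') (0\<^sub>m m n) B\<^sup>T"
    unfolding d using A B by (simp add: transpose_four_block_mat[of _ n m _ m _ n'])
  have "block_diag A B * four_block_mat S S S S = four_block_mat (A * S) (A * S) (B * S) (B * S)"
    unfolding d using A B S by (intro four_block_mat_product[of _ n m _ m _ n' _ _ m _ m]) simp_all
  then show ?thesis
    unfolding T by (simp only:, intro four_block_mat_product[of _ n m _ m _ n' _ _ n _ n']) (use A B S in simp_all)
qed

text \<open>
  The joint distribution obtained by feeding one Gaussian variable to two kernels with independent
  noise. Graph and cograph states are the cases where one of the kernels is the identity.
\<close>

lemma Comp_TenMor_diagonal:
  assumes A: "A \<in> carrier_mat n m" "b \<in> carrier_vec n" "S \<in> carrier_mat n n"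
    and B: "B \<in> carrier_mat n' m" "d \<in> carrier_vec n'" "T \<in> carrier_mat n' n'"
    and p: "\<mu> \<in> carrier_vec m" "\<Sigma> \<in> carrier_mat m m"
  shows "Comp Gauss 0 (m + m) (n + n') (TenMor Gauss m n m n' (A, b, S) (B, d, T))
      (Comp Gauss 0 m (m + m) (Copy Gauss m) (normal_state m \<mu> \<Sigma>))
    = normal_state (n + n') ((b + A *\<^sub>v \<mu>) @\<^sub>v (d + B *\<^sub>v \<mu>))
      (four_block_mat (S + A * \<Sigma> * A\<^sup>T) (A * \<Sigma> * B\<^sup>T) (B * \<Sigma> * A\<^sup>T) (T + B * \<Sigma> * B\<^sup>T))"
proof -
  have d: "block_diag A B = four_block_mat A (0\<^sub>m n m) (0\<^sub>m n' m) B"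
    using A B by (simp add: block_diag_def)
  then have c: "block_diag A B \<in> carrier_mat (n + n') (m + m)"
    using A B by simp
  have zero: "0\<^sub>m k m *\<^sub>v \<mu> = 0\<^sub>v k" for k
    using p(1) by (intro eq_vecI) auto
  have "Comp Gauss 0 (m + m) (n + n') (TenMor Gauss m n m n' (A, b, S) (B, d, T))
      (Comp Gauss 0 m (m + m) (Copy Gauss m) (normal_state m \<mu> \<Sigma>))
    = normal_state (n + n') ((b @\<^sub>v d) + block_diag A B *\<^sub>v (\<mu> @\<^sub>v \<mu>))
      (block_diag S T + block_diag A B * four_block_mat \<Sigma> \<Sigma> \<Sigma> \<Sigma> * (block_diag A B)\<^sup>T)"
    unfolding Comp_Copy_normal_state[OF p] Gauss_sel(7) by (rule Comp_normal_state[OF c])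
  also have "block_diag A B *\<^sub>v (\<mu> @\<^sub>v \<mu>) = (A *\<^sub>v \<mu>) @\<^sub>v (B *\<^sub>v \<mu>)"
    unfolding d four_block_mat_mult_vec[OF A(1) zero_carrier_mat zero_carrier_mat B(1) p(1) p(1)]
    using A(1) B(1) p(1) zero by simp
  also have "(b @\<^sub>v d) + ((A *\<^sub>v \<mu>) @\<^sub>v (B *\<^sub>v \<mu>)) = (b + A *\<^sub>v \<mu>) @\<^sub>v (d + B *\<^sub>v \<mu>)"
    using A B p by (intro append_vec_add) (auto intro: mult_mat_vec_carrier)
  also have "block_diag S T + block_diag A B * four_block_mat \<Sigma> \<Sigma> \<Sigma> \<Sigma> * (block_diag A B)\<^sup>T
    = four_block_mat (S + A * \<Sigma> * A\<^sup>T) (A * \<Sigma> * B\<^sup>T) (B * \<Sigma> * A\<^sup>T) (T + B * \<Sigma> * B\<^sup>T)"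
  proof -
    have S': "block_diag S T = four_block_mat S (0\<^sub>m n n') (0\<^sub>m n' n) T"
      using A B by (simp add: block_diag_def)
    have "A * \<Sigma> * A\<^sup>T \<in> carrier_mat n n" "A * \<Sigma> * B\<^sup>T \<in> carrier_mat n n'"
      "B * \<Sigma> * A\<^sup>T \<in> carrier_mat n' n" "B * \<Sigma> * B\<^sup>T \<in> carrier_mat n' n'" using A B p by auto
    then show ?thesis unfolding S' block_diag_congruence[OF A(1) B(1) p(2)]
      by (subst add_four_block_mat[of _ n n _ n' _ n']) (use A B in auto)
  qed
  finally show ?thesis .
qed

lemma graph_state_normal:
  assumes f: "A \<in> carrier_mat n m" "b \<in> carrier_vec n" "S \<in> carrier_mat n n"
    and p: "\<mu> \<in> carrier_vec m" "\<Sigma> \<in> carrier_mat m m"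
  shows "graph_state Gauss m n (normal_state m \<mu> \<Sigma>) (A, b, S)
    = normal_state (m + n) (\<mu> @\<^sub>v (b + A *\<^sub>v \<mu>))
      (four_block_mat \<Sigma> (\<Sigma> * A\<^sup>T) (A * \<Sigma>) (S + A * \<Sigma> * A\<^sup>T))"
  unfolding graph_state_def Gauss_sel(2-4)
  by (subst Comp_TenMor_diagonal[OF _ _ _ f p]) (use f p in simp_all)

lemma cograph_state_normal:
  assumes g: "B \<in> carrier_mat m n" "c \<in> carrier_vec m" "T \<in> carrier_mat m m"
    and q: "\<nu> \<in> carrier_vec n" "\<Xi> \<in> carrier_mat n n"
  shows "cograph_state Gauss m n (normal_state n \<nu> \<Xi>) (B, c, T)
    = normal_state (m + n) ((c + B *\<^sub>v \<nu>) @\<^sub>v \<nu>)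
      (four_block_mat (T + B * \<Xi> * B\<^sup>T) (B * \<Xi>) (\<Xi> * B\<^sup>T) \<Xi>)"
  unfolding cograph_state_def Gauss_sel(2-4)
  by (subst Comp_TenMor_diagonal[OF g _ _ _ q]) (use g q in simp_all)

lemma as_eq_normal:
  assumes f: "A \<in> carrier_mat n m" "b \<in> carrier_vec n" "S \<in> carrier_mat n n"
    and g: "A' \<in> carrier_mat n m" "b' \<in> carrier_vec n" "S' \<in> carrier_mat n n"
    and p: "\<mu> \<in> carrier_vec m" "\<Sigma> \<in> carrier_mat m m" "\<Sigma>\<^sup>T = \<Sigma>"
  shows "as_eq Gauss m n (normal_state m \<mu> \<Sigma>) (A, b, S) (A', b', S') \<longleftrightarrow>
    A * \<Sigma> = A' * \<Sigma> \<and> b + A *\<^sub>v \<mu> = b' + A' *\<^sub>v \<mu> \<and> S + A * \<Sigma> * A\<^sup>T = S' + A' * \<Sigma> * A'\<^sup>T"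
proof -
  have flip: "\<Sigma> * X\<^sup>T = (X * \<Sigma>)\<^sup>T" if "X \<in> carrier_mat n m" for X
    using transpose_mult[OF that p(2)] p(3) by simp
  have "A * \<Sigma> \<in> carrier_mat n m" "A' * \<Sigma> \<in> carrier_mat n m"
    "\<Sigma> * A\<^sup>T \<in> carrier_mat m n" "\<Sigma> * A'\<^sup>T \<in> carrier_mat m n"
    "S + A * \<Sigma> * A\<^sup>T \<in> carrier_mat n n" "S' + A' * \<Sigma> * A'\<^sup>T \<in> carrier_mat n n"
    using f g p by auto
  note blocks = four_block_mat_eq_iff[OF p(2) this(3) this(1) this(5) p(2) this(4) this(2) this(6)]
  show ?thesis
    unfolding as_eq_def graph_state_normal[OF f p(1,2)] graph_state_normal[OF g p(1,2)]
      normal_state_eq_iff blocks append_vec_eq[OF p(1) p(1)]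
    using flip[OF f(1)] flip[OF g(1)] by auto
qed

section \<open>Almost sure classes as contraction matrices\<close>

text \<open>
  A chosen rank factorization, together with its rank. The identity is made to factor trivially,
  so that the standard space on \<open>\<real>\<^sup>n\<close> gets rank \<open>n\<close> on the nose.
\<close>

definition covariance_factors :: "nat \<Rightarrow> real mat \<Rightarrow> nat \<times> real mat \<times> real mat" where
  "covariance_factors n S = (if S = 1\<^sub>m n then (n, 1\<^sub>m n, 1\<^sub>m n)
     else SOME (r, L, K). rank_factorization n r S L K)"

definition space_rank :: "nat \<times> gauss \<Rightarrow> nat" where
  "space_rank = (\<lambda>(n, _, _, S). fst (covariance_factors n S))"

definition space_root :: "nat \<times> gauss \<Rightarrow> real mat" where
  "space_root = (\<lambda>(n, _, _, S). fst (snd (covariance_factors n S)))"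

text \<open>
  For a contraction \<open>M\<close> this is one full almost sure class. The noise is not mentioned because the
  target covariance determines it.
\<close>

definition gauss_class :: "nat \<times> gauss \<Rightarrow> nat \<times> gauss \<Rightarrow> real mat \<Rightarrow> gauss set" where
  "gauss_class = (\<lambda>(m, p) (n, q) M. {f \<in> Mor Gauss m n. Comp Gauss 0 m n f p = q \<and>
     fst f * space_root (m, p) = space_root (n, q) * M})"

lemma covariance_factors:
  assumes "S \<in> carrier_mat n n" "positive_semidefinite S" "covariance_factors n S = (r, L, K)"
  shows "rank_factorization n r S L K"
proof (cases "S = 1\<^sub>m n")
  case True
  then show ?thesis using assms(3) by (auto simp: covariance_factors_def intro!: rank_factorizationI)
next
  case False
  have "\<exists>x. (\<lambda>(r, L, K). rank_factorization n r S L K) x"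
    using rank_factorization_exists[OF assms(1,2)] by auto
  from someI_ex[OF this] show ?thesis
    using False assms(3) by (simp add: covariance_factors_def)
qed

lemma space_rank_standard [simp]: "space_rank (standard_space n) = n"
  by (simp add: space_rank_def standard_space_def normal_state_def covariance_factors_def)

lemma space_root_standard [simp]: "space_root (standard_space n) = 1\<^sub>m n"
  by (simp add: space_root_def standard_space_def normal_state_def covariance_factors_def)

text \<open>
  Names for the parts of a Gaussian probability space and for its chosen factorization.
\<close>

locale gauss_space =
  fixes X :: "nat \<times> gauss" and m \<mu> \<Sigma> r L K
  assumes eq: "X = (m, normal_state m \<mu> \<Sigma>)"
    and mean: "\<mu> \<in> carrier_vec m" and cov: "\<Sigma> \<in> carrier_mat m m" and psd: "positive_semidefinite \<Sigma>"
    and factors: "rank_factorization m r \<Sigma> L K"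
    and rank: "space_rank X = r" and root: "space_root X = L"
begin

lemmas L = rank_factorizationD(1)[OF factors]
lemmas K = rank_factorizationD(2)[OF factors]
lemmas KL = rank_factorizationD(3)[OF factors]
lemmas LL = rank_factorizationD(4)[OF factors]

lemma sym: "\<Sigma>\<^sup>T = \<Sigma>" using psd by (simp add: positive_semidefinite_def)

lemma congruence_cov:
  assumes "A \<in> carrier_mat n m"
  shows "A * \<Sigma> * A\<^sup>T = (A * L) * (A * L)\<^sup>T"
  using congruence_gram[OF assms L] LL by simp

end

lemma gauss_spaceI:
  assumes "\<mu> \<in> carrier_vec m" "\<Sigma> \<in> carrier_mat m m" "positive_semidefinite \<Sigma>"
  obtains K where "gauss_space (m, normal_state m \<mu> \<Sigma>) m \<mu> \<Sigma> (space_rank (m, normal_state m \<mu> \<Sigma>))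
    (space_root (m, normal_state m \<mu> \<Sigma>)) K"
proof -
  obtain r L K where *: "covariance_factors m \<Sigma> = (r, L, K)" by (metis prod.exhaust)
  show thesis
    by (rule that[of K], unfold_locales)
      (use assms * covariance_factors[OF assms(2,3) *] in \<open>simp_all add: space_rank_def space_root_def normal_state_def\<close>)
qed

lemma gauss_spaceE:
  assumes "X \<in> Ob (prob_spaces Gauss)"
  obtains m \<mu> \<Sigma> r L K where "gauss_space X m \<mu> \<Sigma> r L K"
proof -
  obtain m \<mu> \<Sigma> where X: "X = (m, normal_state m \<mu> \<Sigma>)"
    and *: "\<mu> \<in> carrier_vec m" "\<Sigma> \<in> carrier_mat m m" "positive_semidefinite \<Sigma>"
    using assms by (auto simp: prob_spaces_def Gauss_state)
  show thesis by (rule gauss_spaceI[OF *]) (use that X in blast)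
qed

locale gauss_space_pair = X: gauss_space X m \<mu> \<Sigma> r L K + Y: gauss_space Y n \<nu> \<Xi> s L' K'
  for X m \<mu> \<Sigma> r L K Y n \<nu> \<Xi> s L' K'
begin

lemma mem_gauss_class:
  "(A, b, S) \<in> gauss_class X Y M \<longleftrightarrow> A \<in> carrier_mat n m \<and> b \<in> carrier_vec n \<and> S \<in> carrier_mat n n \<and>
     positive_semidefinite S \<and> b + A *\<^sub>v \<mu> = \<nu> \<and> S + A * \<Sigma> * A\<^sup>T = \<Xi> \<and> A * L = L' * M"
  using X.root Y.root unfolding gauss_class_def X.eq Y.eq
  by (auto simp: Gauss_Mor Comp_normal_state simp del: Gauss_sel)

text \<open>
  A kernel almost surely equal to one in \<open>gauss_class X Y M\<close> has the same pushforward, and it has the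
  same product with \<open>\<Sigma>\<close>, from which the injective factor \<open>L\<^sup>T\<close> on the right can be cancelled.
\<close>

lemma as_class_eq_gauss_class:
  assumes "f \<in> gauss_class X Y M"
  shows "as_class Gauss m n (normal_state m \<mu> \<Sigma>) f = gauss_class X Y M"
proof -
  obtain A b S where f: "f = (A, b, S)" by (cases f)
  note A = assms[unfolded f mem_gauss_class]
  have "(A', b', S') \<in> as_class Gauss m n (normal_state m \<mu> \<Sigma>) f \<longleftrightarrow> (A', b', S') \<in> gauss_class X Y M"
    for A' b' S'
  proof (cases "(A', b', S') \<in> Mor Gauss m n")
    case True
    then have A': "A' \<in> carrier_mat n m" "b' \<in> carrier_vec n" "S' \<in> carrier_mat n n" "positive_semidefinite S'"
      by (auto simp: Gauss_Mor)
    have "as_eq Gauss m n (normal_state m \<mu> \<Sigma>) f (A', b', S') \<longleftrightarrow>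
      A * L = A' * L \<and> \<nu> = b' + A' *\<^sub>v \<mu> \<and> \<Xi> = S' + A' * \<Sigma> * A'\<^sup>T"
    proof -
      have "A * \<Sigma> = A' * \<Sigma> \<longleftrightarrow> A * L = A' * L"
        using rank_factorization_mult_cancel[OF X.factors] A A' by blast
      then show ?thesis
        using as_eq_normal[of A n m b S A' b' S', OF _ _ _ A'(1-3) X.mean X.cov X.sym] A
        unfolding f by auto
    qed
    then show ?thesis using True A A' by (auto simp: as_class_def mem_gauss_class)
  next
    case False
    then show ?thesis by (auto simp: as_class_def mem_gauss_class Gauss_Mor)
  qed
  then show ?thesis by (metis subset_antisym subsetI prod.exhaust)
qed

lemma gauss_class_of_morphism:
  assumes f: "(A, b, S) \<in> Mor Gauss m n" "Comp Gauss 0 m n (A, b, S) (normal_state m \<mu> \<Sigma>) = normal_state n \<nu> \<Xi>"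
  shows "(A, b, S) \<in> gauss_class X Y (K' * (A * L))" "K' * (A * L) \<in> Mor Con r s"
proof -
  have A: "A \<in> carrier_mat n m" "b \<in> carrier_vec n" "S \<in> carrier_mat n n" "positive_semidefinite S"
    using f by (auto simp: Gauss_Mor)
  have "normal_state n (b + A *\<^sub>v \<mu>) (S + A * \<Sigma> * A\<^sup>T) = normal_state n \<nu> \<Xi>"
    using f(2) unfolding Comp_normal_state[OF A(1)] .
  then have eqs: "b + A *\<^sub>v \<mu> = \<nu>" "S + A * \<Sigma> * A\<^sup>T = \<Xi>" by auto
  have AL: "A * L \<in> carrier_mat n r" using A X.L by simp
  have "\<Xi> = S + (A * L) * (A * L)\<^sup>T" using eqs(2) X.congruence_cov[OF A(1)] by simp
  note * = pushforward_coordinates[OF Y.factors AL A(3,4) this]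
  show "(A, b, S) \<in> gauss_class X Y (K' * (A * L))"
    unfolding mem_gauss_class using A eqs *(1) by blast
  show "K' * (A * L) \<in> Mor Con r s"
    using *(2) AL Y.K by (simp add: Con_def)
qed

text \<open>
  The kernel of \<open>M\<close> transports coordinates by \<open>L' M K\<close>; the contraction property of \<open>M\<close> is exactly
  what makes the missing covariance \<open>L' (I - M M\<^sup>T) L'\<^sup>T\<close> admissible as noise.
\<close>

lemma gauss_class_nonempty:
  assumes "M \<in> Mor Con r s"
  obtains A b S where "(A, b, S) \<in> gauss_class X Y M"
proof
  have M: "M \<in> carrier_mat s r" and psd: "positive_semidefinite (1\<^sub>m s - M * M\<^sup>T)"
    using assms contraction_iff_psd by (auto simp: Con_def)
  have MM: "M * M\<^sup>T \<in> carrier_mat s s" using M by simp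
  have L'M: "L' * M \<in> carrier_mat n r" using Y.L M by simp
  \<comment> \<open>the mean is adjusted by a constant offset at the end\<close>
  let ?A = "L' * M * K" and ?S = "L' * (1\<^sub>m s - M * M\<^sup>T) * L'\<^sup>T"
  have A: "?A \<in> carrier_mat n m" using L'M X.K by simp
  have "?A * L = L' * M * (K * L)" using L'M X.K X.L by (rule assoc_mult_mat)
  then have AL: "?A * L = L' * M" unfolding X.KL right_mult_one_mat[OF L'M] .
  have S: "?S \<in> carrier_mat n n" using Y.L MM by auto
  have "?S + ?A * \<Sigma> * ?A\<^sup>T = ?S + L' * (M * M\<^sup>T) * L'\<^sup>T"
    unfolding X.congruence_cov[OF A] AL congruence_gram[OF Y.L M] ..
  also have "\<dots> = L' * (1\<^sub>m s - M * M\<^sup>T + M * M\<^sup>T) * L'\<^sup>T"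
    using Y.L MM minus_carrier_mat[OF MM] by (subst congruence_add) auto
  also have "1\<^sub>m s - M * M\<^sup>T + M * M\<^sup>T = 1\<^sub>m s"
    using MM by (intro eq_matI) auto
  also have "L' * 1\<^sub>m s * L'\<^sup>T = \<Xi>" using Y.L Y.LL by simp
  finally have "?S + ?A * \<Sigma> * ?A\<^sup>T = \<Xi>" .
  moreover have "\<nu> - v \<in> carrier_vec n \<and> \<nu> - v + v = \<nu>" if "v \<in> carrier_vec n" for v
    using Y.mean that by (auto intro!: eq_vecI)
  note this[OF mult_mat_vec_carrier[OF A X.mean]]
  moreover have "positive_semidefinite ?S"
    using positive_semidefinite_congruence[OF psd minus_carrier_mat[OF MM] Y.L] .
  ultimately show "(?A, \<nu> - ?A *\<^sub>v \<mu>, ?S) \<in> gauss_class X Y M"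
    unfolding mem_gauss_class using A S AL by blast
qed

lemma gauss_class_inj: "inj_on (gauss_class X Y) (Mor Con r s)"
proof
  fix M N assume M: "M \<in> Mor Con r s" "N \<in> Mor Con r s" and eq: "gauss_class X Y M = gauss_class X Y N"
  obtain A b S where "(A, b, S) \<in> gauss_class X Y M" using gauss_class_nonempty M(1) by blast
  with eq have "L' * M = L' * N" by (metis mem_gauss_class)
  then show "M = N" using rank_factorization_left_cancel[OF Y.factors, of M r N] M by (simp add: Con_def)
qed

lemma prob_spaces_Mor: "Mor (prob_spaces Gauss) X Y = gauss_class X Y ` Mor Con r s"
proof (intro equalityI subsetI)
  fix \<alpha> assume "\<alpha> \<in> Mor (prob_spaces Gauss) X Y"
  then obtain A b S where f: "(A, b, S) \<in> Mor Gauss m n"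
      "Comp Gauss 0 m n (A, b, S) (normal_state m \<mu> \<Sigma>) = normal_state n \<nu> \<Xi>"
      "\<alpha> = as_class Gauss m n (normal_state m \<mu> \<Sigma>) (A, b, S)"
    unfolding X.eq Y.eq by (auto simp: prob_spaces_def simp del: Gauss_sel(6))
  note * = gauss_class_of_morphism[OF f(1,2)]
  show "\<alpha> \<in> gauss_class X Y ` Mor Con r s"
    unfolding f(3) as_class_eq_gauss_class[OF *(1)] using *(2) by blast
next
  fix \<alpha> assume "\<alpha> \<in> gauss_class X Y ` Mor Con r s"
  then obtain M where M: "M \<in> Mor Con r s" "\<alpha> = gauss_class X Y M" by blast
  then obtain A b S where f: "(A, b, S) \<in> gauss_class X Y M" using gauss_class_nonempty by blast
  have "(A, b, S) \<in> Mor Gauss m n" "Comp Gauss 0 m n (A, b, S) (normal_state m \<mu> \<Sigma>) = normal_state n \<nu> \<Xi>"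
    using f by (auto simp: mem_gauss_class Gauss_Mor Comp_normal_state simp del: Gauss_sel)
  then show "\<alpha> \<in> Mor (prob_spaces Gauss) X Y"
    using M(2) as_class_eq_gauss_class[OF f] unfolding X.eq Y.eq
    by (auto simp: prob_spaces_def simp del: Gauss_sel(6))
qed

text \<open>
  Comparing the blocks of the two joint covariance matrices: the diagonal blocks and the means say
  that \<open>g\<close> maps \<open>q\<close> back to \<open>p\<close>, and the off-diagonal block says \<open>\<Sigma> A\<^sup>T = B \<Xi>\<close>. In terms of factors
  the latter reads \<open>L M\<^sup>T L'\<^sup>T = B L' L'\<^sup>T\<close>, where \<open>L'\<^sup>T\<close> cancels.
\<close>

lemma bayesian_inverse_iff:
  assumes f: "(A, b, S) \<in> gauss_class X Y M" and M: "M \<in> carrier_mat s r"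
  shows "bayesian_inverse Gauss m n (normal_state m \<mu> \<Sigma>) (A, b, S) g \<longleftrightarrow> g \<in> gauss_class Y X M\<^sup>T"
proof -
  interpret rev: gauss_space_pair Y n \<nu> \<Xi> s L' K' X m \<mu> \<Sigma> r L K ..
  obtain B c T where g: "g = (B, c, T)" by (cases g)
  note A = f[unfolded mem_gauss_class]
  have push: "Comp Gauss (Unit Gauss) m n (A, b, S) (normal_state m \<mu> \<Sigma>) = normal_state n \<nu> \<Xi>"
    using A by (simp add: Comp_normal_state del: Gauss_sel(6))
  show ?thesis
  proof (cases "g \<in> Mor Gauss n m")
    case False
    then show ?thesis unfolding g by (auto simp: bayesian_inverse_def Gauss_Mor rev.mem_gauss_class)
  next
    case True
    then have B: "B \<in> carrier_mat m n" "c \<in> carrier_vec m" "T \<in> carrier_mat m m" "positive_semidefinite T"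
      unfolding g by (auto simp: Gauss_Mor)
    have AS: "A * \<Sigma> = (\<Sigma> * A\<^sup>T)\<^sup>T" "B * \<Xi> = (\<Xi> * B\<^sup>T)\<^sup>T"
      using transpose_mult[of \<Sigma> m m "A\<^sup>T" n] transpose_mult[of \<Xi> n n "B\<^sup>T" m] A B X.cov Y.cov X.sym Y.sym
      by simp_all
    have car: "\<Sigma> * A\<^sup>T \<in> carrier_mat m n" "A * \<Sigma> \<in> carrier_mat n m" "T + B * \<Xi> * B\<^sup>T \<in> carrier_mat m m"
      "B * \<Xi> \<in> carrier_mat m n" "\<Xi> * B\<^sup>T \<in> carrier_mat n m" using A B X.cov Y.cov by auto
    have "graph_state Gauss m n (normal_state m \<mu> \<Sigma>) (A, b, S)
        = normal_state (m + n) (\<mu> @\<^sub>v \<nu>) (four_block_mat \<Sigma> (\<Sigma> * A\<^sup>T) (A * \<Sigma>) \<Xi>)"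
      using graph_state_normal[of A n m b S \<mu> \<Sigma>] A X.mean X.cov by simp
    then have "bayesian_inverse Gauss m n (normal_state m \<mu> \<Sigma>) (A, b, S) g \<longleftrightarrow>
        \<mu> = c + B *\<^sub>v \<nu> \<and> \<Sigma> = T + B * \<Xi> * B\<^sup>T \<and> \<Sigma> * A\<^sup>T = B * \<Xi> \<and> A * \<Sigma> = \<Xi> * B\<^sup>T"
      unfolding bayesian_inverse_def push using True unfolding g
      using B X.mean Y.mean X.cov Y.cov mult_mat_vec_carrier[OF B(1) Y.mean]
      by (simp add: cograph_state_normal append_vec_eq[of _ m] car
          four_block_mat_eq_iff[of _ m m _ n _ n])
    moreover have "\<Sigma> * A\<^sup>T = B * \<Xi> \<longleftrightarrow> A * \<Sigma> = \<Xi> * B\<^sup>T"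
      using AS by (metis transpose_transpose)
    moreover have "\<Sigma> * A\<^sup>T = B * \<Xi> \<longleftrightarrow> B * L' = L * M\<^sup>T"
    proof -
      have "\<Sigma> * A\<^sup>T = L * L\<^sup>T * A\<^sup>T" using X.LL by simp
      also have "\<dots> = L * (A * L)\<^sup>T"
      proof -
        have "(A * L)\<^sup>T = L\<^sup>T * A\<^sup>T" using A X.L by (intro transpose_mult) auto
        moreover have "L * L\<^sup>T * A\<^sup>T = L * (L\<^sup>T * A\<^sup>T)" using A X.L by (intro assoc_mult_mat) auto
        ultimately show ?thesis by simp
      qed
      also have "\<dots> = L * (M\<^sup>T * L'\<^sup>T)" using A transpose_mult[OF Y.L M] by simp
      also have "\<dots> = (L * M\<^sup>T) * L'\<^sup>T"
        using X.L M Y.L by (intro assoc_mult_mat[symmetric]) auto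
      finally have 1: "\<Sigma> * A\<^sup>T = (L * M\<^sup>T) * L'\<^sup>T" .
      have 2: "B * \<Xi> = (B * L') * L'\<^sup>T"
        using B(1) Y.L unfolding Y.LL[symmetric] by (intro assoc_mult_mat[symmetric]) auto
      have "L * M\<^sup>T \<in> carrier_mat m s" "B * L' \<in> carrier_mat m s" using X.L M B Y.L by auto
      from rank_factorization_right_cancel[OF Y.factors this] show ?thesis
        unfolding 1 2 by auto
    qed
    ultimately show ?thesis using B unfolding g rev.mem_gauss_class by auto
  qed
qed

lemma Dag_gauss_class:
  assumes "M \<in> Mor Con r s"
  shows "Dag (prob_spaces Gauss) X Y (gauss_class X Y M) = gauss_class Y X M\<^sup>T"
proof -
  interpret rev: gauss_space_pair Y n \<nu> \<Xi> s L' K' X m \<mu> \<Sigma> r L K ..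
  have M: "M \<in> carrier_mat s r" "M\<^sup>T \<in> Mor Con s r"
    using assms contraction_transpose by (auto simp: Con_def)
  have "(\<Union>g\<in>{g. bayesian_inverse Gauss m n (normal_state m \<mu> \<Sigma>) f g}. as_class Gauss n m (normal_state n \<nu> \<Xi>) g)
      = gauss_class Y X M\<^sup>T" if "f \<in> gauss_class X Y M" for f
  proof -
    obtain A b S where f: "f = (A, b, S)" by (cases f)
    have "(\<Union>g\<in>gauss_class Y X M\<^sup>T. as_class Gauss n m (normal_state n \<nu> \<Xi>) g) = (\<Union>g\<in>gauss_class Y X M\<^sup>T. gauss_class Y X M\<^sup>T)"
      by (intro SUP_cong refl rev.as_class_eq_gauss_class)
    then show ?thesis
      using bayesian_inverse_iff[OF that[unfolded f] M(1)] unfolding f by auto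
  qed
  then have "Dag (prob_spaces Gauss) X Y (gauss_class X Y M) = (\<Union>f\<in>gauss_class X Y M. gauss_class Y X M\<^sup>T)"
    by (subst (1) X.eq, subst (1) Y.eq) (simp add: prob_spaces_def)
  then show ?thesis using gauss_class_nonempty[OF assms] by blast
qed

end

section \<open>Contractions, co-isometries and determinism\<close>

lemma Con_sel [simp]:
  "Ob Con = UNIV" "Ident Con n = 1\<^sub>m n" "Comp Con k l j A B = A * B" "Dag Con k l A = A\<^sup>T"
  by (simp_all add: Con_def)

lemma Con_Mor: "M \<in> Mor Con m n \<longleftrightarrow> M \<in> carrier_mat n m \<and> contraction M"
  by (simp add: Con_def)

lemma CoIsom_sel [simp]:
  "Ob CoIsom = UNIV" "Ident CoIsom n = 1\<^sub>m n" "Comp CoIsom k l j A B = A * B"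
  by (simp_all add: CoIsom_def)

lemma CoIsom_Mor: "M \<in> Mor CoIsom m n \<longleftrightarrow> M \<in> carrier_mat n m \<and> M * M\<^sup>T = 1\<^sub>m n"
  by (simp add: CoIsom_def)

lemma contraction_mult:
  assumes A: "A \<in> carrier_mat n m" "contraction A" and B: "B \<in> carrier_mat m k" "contraction B"
  shows "contraction (A * B)"
proof -
  have "((A * B) *\<^sub>v x) \<bullet> ((A * B) *\<^sub>v x) \<le> x \<bullet> x" if x: "x \<in> carrier_vec k" for x
  proof -
    have Bx: "B *\<^sub>v x \<in> carrier_vec m" using B(1) x by (rule mult_mat_vec_carrier)
    have "(A *\<^sub>v (B *\<^sub>v x)) \<bullet> (A *\<^sub>v (B *\<^sub>v x)) \<le> (B *\<^sub>v x) \<bullet> (B *\<^sub>v x)"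
      using A Bx contraction_iff by blast
    also have "\<dots> \<le> x \<bullet> x" using B x contraction_iff by blast
    finally show ?thesis using assoc_mult_mat_vec[OF A(1) B(1) x] by simp
  qed
  then show ?thesis using contraction_iff[of "A * B" n k] A B by simp
qed

lemma contraction_one: "contraction (1\<^sub>m n)"
  by (rule coisometry_contraction[of _ n n]) simp_all

interpretation Con: dagger_category Con
  by unfold_locales
    (auto simp: Con_Mor contraction_mult contraction_one contraction_transpose transpose_mult)

interpretation CoIsom: category CoIsom
proof
  fix k m n A B assume A: "A \<in> Mor CoIsom k m" and B: "B \<in> Mor CoIsom m n"
  have car: "A \<in> carrier_mat m k" "B \<in> carrier_mat n m" using A B by (auto simp: CoIsom_Mor)
  have "B * (A * A\<^sup>T) * B\<^sup>T = (B * A) * (B * A)\<^sup>T" using car(2,1) by (rule congruence_gram)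
  then have "(B * A) * (B * A)\<^sup>T = 1\<^sub>m n" using A B by (auto simp: CoIsom_Mor)
  then show "Comp CoIsom k m n B A \<in> Mor CoIsom k n" using car by (simp add: CoIsom_Mor)
qed (auto simp: CoIsom_Mor)

lemma CoIsom_subset_Con: "Mor CoIsom m n \<subseteq> Mor Con m n"
  using coisometry_contraction by (auto simp: CoIsom_Mor Con_Mor)

lemma (in gauss_space) Ident_gauss_class: "Ident (prob_spaces Gauss) X = gauss_class X X (1\<^sub>m r)"
proof -
  interpret gauss_space_pair X m \<mu> \<Sigma> r L K X m \<mu> \<Sigma> r L K ..
  have "positive_semidefinite (0\<^sub>m m m)"
    using gram_positive_semidefinite[of "0\<^sub>m m m" m m] by simp
  then have "Ident Gauss m \<in> gauss_class X X (1\<^sub>m r)"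
    using mean cov L by (simp add: mem_gauss_class)
  from as_class_eq_gauss_class[OF this] show ?thesis
    unfolding eq by (simp add: prob_spaces_def)
qed

lemma Comp_gauss_class:
  assumes "gauss_space X m \<mu> \<Sigma> r L K" "gauss_space Y n \<nu> \<Xi> s L' K'" "gauss_space Z k \<xi> \<Upsilon> t L'' K''"
    and M: "M \<in> Mor Con r s" and N: "N \<in> Mor Con s t"
  shows "Comp (prob_spaces Gauss) X Y Z (gauss_class Y Z N) (gauss_class X Y M) = gauss_class X Z (N * M)"
proof -
  interpret X: gauss_space X m \<mu> \<Sigma> r L K by fact
  interpret Y: gauss_space Y n \<nu> \<Xi> s L' K' by fact
  interpret Z: gauss_space Z k \<xi> \<Upsilon> t L'' K'' by fact
  interpret XY: gauss_space_pair X m \<mu> \<Sigma> r L K Y n \<nu> \<Xi> s L' K' ..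
  interpret YZ: gauss_space_pair Y n \<nu> \<Xi> s L' K' Z k \<xi> \<Upsilon> t L'' K'' ..
  interpret XZ: gauss_space_pair X m \<mu> \<Sigma> r L K Z k \<xi> \<Upsilon> t L'' K'' ..
  have MN: "M \<in> carrier_mat s r" "N \<in> carrier_mat t s" using M N by (auto simp: Con_Mor)
  have mem: "Comp Gauss m n k g f \<in> gauss_class X Z (N * M)"
    if "f \<in> gauss_class X Y M" "g \<in> gauss_class Y Z N" for f g
  proof -
    obtain A b S B c T where f: "f = (A, b, S)" and g: "g = (B, c, T)" by (metis prod.exhaust)
    note * = that[unfolded f g XY.mem_gauss_class YZ.mem_gauss_class]
    have A: "A \<in> carrier_mat n m" "b \<in> carrier_vec n" "S \<in> carrier_mat n n" "positive_semidefinite S"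
        "b + A *\<^sub>v \<mu> = \<nu>" "S + A * \<Sigma> * A\<^sup>T = \<Xi>" "A * L = L' * M"
      and B: "B \<in> carrier_mat k n" "c \<in> carrier_vec k" "T \<in> carrier_mat k k" "positive_semidefinite T"
        "c + B *\<^sub>v \<nu> = \<xi>" "T + B * \<Xi> * B\<^sup>T = \<Upsilon>" "B * L' = L'' * N"
      using * by auto
    have "c + B *\<^sub>v b + (B * A) *\<^sub>v \<mu> = \<xi>"
    proof -
      have "A *\<^sub>v \<mu> \<in> carrier_vec n" using A(1) X.mean by (rule mult_mat_vec_carrier)
      then have "B *\<^sub>v \<nu> = B *\<^sub>v b + B *\<^sub>v (A *\<^sub>v \<mu>)"
        unfolding A(5)[symmetric] using A(2) B(1) by (intro mult_add_distrib_mat_vec) auto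
      moreover have "B *\<^sub>v (A *\<^sub>v \<mu>) = (B * A) *\<^sub>v \<mu>"
        using A(1) B(1) X.mean by (intro assoc_mult_mat_vec[symmetric]) auto
      moreover have "B *\<^sub>v b \<in> carrier_vec k" "(B * A) *\<^sub>v \<mu> \<in> carrier_vec k"
        using mult_mat_vec_carrier[OF B(1) A(2)] mult_mat_vec_carrier[OF mult_carrier_mat[OF B(1) A(1)] X.mean] .
      ultimately show ?thesis unfolding B(5)[symmetric] using assoc_add_vec[OF B(2)] by simp
    qed
    moreover have "T + B * S * B\<^sup>T + (B * A) * \<Sigma> * (B * A)\<^sup>T = \<Upsilon>"
    proof -
      have G: "A * \<Sigma> * A\<^sup>T \<in> carrier_mat n n" using A(1) X.cov by auto
      have "B * \<Xi> * B\<^sup>T = B * S * B\<^sup>T + B * (A * \<Sigma> * A\<^sup>T) * B\<^sup>T"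
        unfolding A(6)[symmetric] by (rule congruence_add[OF B(1) A(3) G])
      moreover have "B * (A * \<Sigma> * A\<^sup>T) * B\<^sup>T = (B * A) * \<Sigma> * (B * A)\<^sup>T"
        by (rule congruence_assoc[OF B(1) A(1) X.cov])
      moreover have "B * S * B\<^sup>T \<in> carrier_mat k k" "(B * A) * \<Sigma> * (B * A)\<^sup>T \<in> carrier_mat k k"
        using A(1,3) B(1) X.cov by auto
      ultimately show ?thesis unfolding B(6)[symmetric] using assoc_add_mat[OF B(3)] by simp
    qed
    moreover have "(B * A) * L = L'' * (N * M)"
    proof -
      have "(B * A) * L = B * (L' * M)"
        unfolding A(7)[symmetric] using B(1) A(1) X.L by (rule assoc_mult_mat)
      also have "\<dots> = (L'' * N) * M"
        unfolding B(7)[symmetric] using B(1) Y.L MN(1) by (rule assoc_mult_mat[symmetric])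
      also have "\<dots> = L'' * (N * M)" using Z.L MN(2,1) by (rule assoc_mult_mat)
      finally show ?thesis .
    qed
    moreover have "positive_semidefinite (T + B * S * B\<^sup>T)"
      using positive_semidefinite_add[OF B(4) positive_semidefinite_congruence[OF A(4,3) B(1)] B(3)] A(3) B(1)
      by auto
    moreover have "c + B *\<^sub>v b \<in> carrier_vec k" "T + B * S * B\<^sup>T \<in> carrier_mat k k" "B * A \<in> carrier_mat k m"
      using mult_mat_vec_carrier[OF B(1) A(2)] A(1,3) B(1-3) by auto
    ultimately show ?thesis unfolding f g XZ.mem_gauss_class by (simp add: XZ.mem_gauss_class)
  qed
  have "Comp (prob_spaces Gauss) X Y Z (gauss_class Y Z N) (gauss_class X Y M)
      = (\<Union>g\<in>gauss_class Y Z N. \<Union>f\<in>gauss_class X Y M. as_class Gauss m k (normal_state m \<mu> \<Sigma>) (Comp Gauss m n k g f))"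
    by (subst (1) X.eq, subst (1) Y.eq, subst (1) Z.eq) (simp add: prob_spaces_def del: Gauss_sel(6))
  also have "\<dots> = (\<Union>g\<in>gauss_class Y Z N. \<Union>f\<in>gauss_class X Y M. gauss_class X Z (N * M))"
    by (intro SUP_cong refl XZ.as_class_eq_gauss_class mem)
  also have "\<dots> = gauss_class X Z (N * M)"
  proof -
    have "gauss_class X Y M \<noteq> {}" using XY.gauss_class_nonempty[OF M] by (metis empty_iff)
    moreover have "gauss_class Y Z N \<noteq> {}" using YZ.gauss_class_nonempty[OF N] by (metis empty_iff)
    ultimately show ?thesis by simp
  qed
  finally show ?thesis .
qed

lemma add_mat_right_cancel:
  fixes A :: "real mat"
  assumes "A \<in> carrier_mat n m" "B \<in> carrier_mat n m" "C \<in> carrier_mat n m"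
  shows "A + C = B + C \<longleftrightarrow> A = B"
proof
  assume eq: "A + C = B + C"
  have "X + C - C = X" if "X \<in> carrier_mat n m" for X
    using that assms(3) by (intro eq_matI) auto
  then show "A = B" using assms(1,2) eq by metis
qed simp

lemma copy_mult:
  fixes A :: "real mat"
  assumes A: "A \<in> carrier_mat n m"
  shows "(1\<^sub>m n @\<^sub>r 1\<^sub>m n) * A = A @\<^sub>r A" "block_diag A A * (1\<^sub>m m @\<^sub>r 1\<^sub>m m) = A @\<^sub>r A"
proof -
  have AA: "A @\<^sub>r A = four_block_mat A (0\<^sub>m n 0) A (0\<^sub>m n 0)" using A by (simp add: append_rows_def)
  have copy: "1\<^sub>m k @\<^sub>r 1\<^sub>m k = four_block_mat (1\<^sub>m k) (0\<^sub>m k 0) (1\<^sub>m k) (0\<^sub>m k 0 :: real mat)" for k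
    by (simp add: append_rows_def)
  have A0: "A = four_block_mat A (0\<^sub>m n 0) (0\<^sub>m 0 m) (0\<^sub>m 0 0)"
    using A by (intro eq_matI) auto
  show "(1\<^sub>m n @\<^sub>r 1\<^sub>m n) * A = A @\<^sub>r A"
    unfolding AA copy
    by (subst A0, rule four_block_mat_product[of _ n n _ 0 _ n _ _ m _ 0]) (use A in simp_all)
  have d: "block_diag A A = four_block_mat A (0\<^sub>m n m) (0\<^sub>m n m) A"
    using A by (simp add: block_diag_def)
  show "block_diag A A * (1\<^sub>m m @\<^sub>r 1\<^sub>m m) = A @\<^sub>r A"
    unfolding AA copy d
    by (rule four_block_mat_product[of _ n m _ m _ n _ _ m _ 0]) (use A in simp_all)
qed

text \<open>
  Copying the output of a noisy kernel correlates the two copies of the noise perfectly, whereas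
  applying the kernel twice gives independent noises. The joint distributions differ exactly in
  the off-diagonal blocks \<open>S\<close> and \<open>0\<close>.
\<close>

lemma as_deterministic_iff:
  assumes A: "A \<in> carrier_mat n m" "b \<in> carrier_vec n" "S \<in> carrier_mat n n"
    and p: "\<mu> \<in> carrier_vec m" "\<Sigma> \<in> carrier_mat m m" "\<Sigma>\<^sup>T = \<Sigma>"
  shows "as_deterministic Gauss m n (normal_state m \<mu> \<Sigma>) (A, b, S) \<longleftrightarrow> S = 0\<^sub>m n n"
proof -
  have AA: "A @\<^sub>r A \<in> carrier_mat (n + n) m" using A by simp
  have bd: "block_diag S S = four_block_mat S (0\<^sub>m n n) (0\<^sub>m n n) S"
    using A by (simp add: block_diag_def)
  have car: "four_block_mat S S S S \<in> carrier_mat (n + n) (n + n)"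
    "four_block_mat S (0\<^sub>m n n) (0\<^sub>m n n) S \<in> carrier_mat (n + n) (n + n)"
    using A by auto
  have 1: "Comp Gauss m n (n + n) (Copy Gauss n) (A, b, S) = (A @\<^sub>r A, b @\<^sub>v b, four_block_mat S S S S)"
  proof -
    have "(1\<^sub>m n @\<^sub>r 1\<^sub>m n) *\<^sub>v b = b @\<^sub>v b"
      using A(2) by (subst mat_mult_append[of _ n n _ n]) auto
    then show ?thesis
      using A(2) car(1) by (simp add: copy_mult[OF A(1)] copy_congruence[OF A(3)])
  qed
  have 2: "Comp Gauss m (m + m) (n + n) (TenMor Gauss m n m n (A, b, S) (A, b, S)) (Copy Gauss m)
      = (A @\<^sub>r A, b @\<^sub>v b, four_block_mat S (0\<^sub>m n n) (0\<^sub>m n n) S)"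
  proof -
    have c: "block_diag A A \<in> carrier_mat (n + n) (m + m)"
      using A by (simp add: block_diag_def)
    have "block_diag A A *\<^sub>v 0\<^sub>v (m + m) = 0\<^sub>v (n + n)" using c by (intro eq_vecI) auto
    moreover have "block_diag A A * 0\<^sub>m (m + m) (m + m) * (block_diag A A)\<^sup>T = 0\<^sub>m (n + n) (n + n)"
      using c by simp
    ultimately show ?thesis
      using A(2) car(2) by (simp add: copy_mult[OF A(1)] bd)
  qed
  have bb: "b @\<^sub>v b \<in> carrier_vec (n + n)" using A(2) by simp
  have W: "(A @\<^sub>r A) * \<Sigma> * (A @\<^sub>r A)\<^sup>T \<in> carrier_mat (n + n) (n + n)"
    using AA p(2) by auto
  have "as_deterministic Gauss m n (normal_state m \<mu> \<Sigma>) (A, b, S) \<longleftrightarrow>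
      four_block_mat S S S S = four_block_mat S (0\<^sub>m n n) (0\<^sub>m n n) S"
    unfolding as_deterministic_def Gauss_sel(3) 1 2
      as_eq_normal[OF AA bb car(1) AA bb car(2) p] add_mat_right_cancel[OF car W] by simp
  also have "\<dots> \<longleftrightarrow> S = 0\<^sub>m n n"
    by (subst four_block_mat_eq_iff[of _ n n _ n _ n]) (use A(3) in auto)
  finally show ?thesis .
qed

context gauss_space_pair
begin

text \<open>
  In the class of \<open>M\<close> the target covariance \<open>L' L'\<^sup>T\<close> equals \<open>S + L' M M\<^sup>T L'\<^sup>T\<close>, and \<open>L'\<close> cancels on
  both sides.
\<close>

lemma noiseless_iff:
  assumes f: "(A, b, S) \<in> gauss_class X Y M" and M: "M \<in> carrier_mat s r"
  shows "S = 0\<^sub>m n n \<longleftrightarrow> M * M\<^sup>T = 1\<^sub>m s"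
proof -
  note A = f[unfolded mem_gauss_class]
  have MM: "M * M\<^sup>T \<in> carrier_mat s s" using M by simp
  have S: "S \<in> carrier_mat n n" using A by simp
  have N: "L' * (M * M\<^sup>T) * L'\<^sup>T \<in> carrier_mat n n" using Y.L MM by auto
  have "A * \<Sigma> * A\<^sup>T = L' * (M * M\<^sup>T) * L'\<^sup>T"
    using X.congruence_cov[of A n] A congruence_gram[OF Y.L M] by simp
  then have "0\<^sub>m n n + \<Xi> = S + L' * (M * M\<^sup>T) * L'\<^sup>T" using A Y.cov by auto
  then have "S = 0\<^sub>m n n \<longleftrightarrow> \<Xi> = L' * (M * M\<^sup>T) * L'\<^sup>T"
    using add_mat_right_cancel[OF zero_carrier_mat S N] Y.cov N left_add_zero_mat by metis
  also have "\<dots> \<longleftrightarrow> (L' * 1\<^sub>m s) * L'\<^sup>T = (L' * (M * M\<^sup>T)) * L'\<^sup>T"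
    using Y.L Y.LL by simp
  also have "\<dots> \<longleftrightarrow> L' * 1\<^sub>m s = L' * (M * M\<^sup>T)"
    using Y.L MM by (intro rank_factorization_right_cancel[OF Y.factors]) auto
  also have "\<dots> \<longleftrightarrow> M * M\<^sup>T = 1\<^sub>m s"
    using rank_factorization_left_cancel[OF Y.factors, of "1\<^sub>m s" s "M * M\<^sup>T"] MM by auto
  finally show ?thesis .
qed

lemma as_deterministic_gauss_class:
  assumes f: "(A, b, S) \<in> gauss_class X Y M" and M: "M \<in> carrier_mat s r"
  shows "as_deterministic Gauss m n (normal_state m \<mu> \<Sigma>) (A, b, S) \<longleftrightarrow> M \<in> Mor CoIsom r s"
  using as_deterministic_iff[of A n m b S \<mu> \<Sigma>] f X.mean X.cov X.sym noiseless_iff[OF f M] M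
  unfolding mem_gauss_class CoIsom_Mor by blast

lemma sample_spaces_Mor: "Mor (sample_spaces Gauss) X Y = gauss_class X Y ` Mor CoIsom r s"
proof (intro equalityI subsetI)
  fix \<alpha> assume "\<alpha> \<in> Mor (sample_spaces Gauss) X Y"
  then obtain A b S where f: "(A, b, S) \<in> Mor Gauss m n"
      "Comp Gauss 0 m n (A, b, S) (normal_state m \<mu> \<Sigma>) = normal_state n \<nu> \<Xi>"
      "\<alpha> = as_class Gauss m n (normal_state m \<mu> \<Sigma>) (A, b, S)"
      "as_deterministic Gauss m n (normal_state m \<mu> \<Sigma>) (A, b, S)"
    unfolding X.eq Y.eq by (auto simp: sample_spaces_def simp del: Gauss_sel(6))
  note * = gauss_class_of_morphism[OF f(1,2)]
  show "\<alpha> \<in> gauss_class X Y ` Mor CoIsom r s"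
    unfolding f(3) as_class_eq_gauss_class[OF *(1)]
    using as_deterministic_gauss_class[OF *(1)] f(4) *(2) by (simp add: Con_Mor)
next
  fix \<alpha> assume "\<alpha> \<in> gauss_class X Y ` Mor CoIsom r s"
  then obtain M where M: "M \<in> Mor CoIsom r s" "\<alpha> = gauss_class X Y M" by blast
  then obtain A b S where f: "(A, b, S) \<in> gauss_class X Y M"
    using gauss_class_nonempty CoIsom_subset_Con by blast
  have "(A, b, S) \<in> Mor Gauss m n" "Comp Gauss 0 m n (A, b, S) (normal_state m \<mu> \<Sigma>) = normal_state n \<nu> \<Xi>"
    using f by (auto simp: mem_gauss_class Gauss_Mor Comp_normal_state simp del: Gauss_sel)
  moreover have "as_deterministic Gauss m n (normal_state m \<mu> \<Sigma>) (A, b, S)"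
    using as_deterministic_gauss_class[OF f] M(1) by (simp add: CoIsom_Mor)
  ultimately show "\<alpha> \<in> Mor (sample_spaces Gauss) X Y"
    using M(2) as_class_eq_gauss_class[OF f] unfolding X.eq Y.eq
    by (auto simp: sample_spaces_def simp del: Gauss_sel(6))
qed

end

lemma sample_spaces_sel [simp]:
  "Ob (sample_spaces C) = Ob (prob_spaces C)" "Ident (sample_spaces C) = Ident (prob_spaces C)"
  "Comp (sample_spaces C) = Comp (prob_spaces C)"
  by (simp_all add: sample_spaces_def)

lemma normal_space_Ob:
  assumes "b \<in> carrier_vec n" "S \<in> carrier_mat n n" "positive_semidefinite S"
  shows "(n, normal_state n b S) \<in> Ob (prob_spaces Gauss)"
  using assms by (auto simp: prob_spaces_def Gauss_state)

lemma standard_space_Ob: "standard_space n \<in> Ob (prob_spaces Gauss)"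
  using gram_positive_semidefinite[of "1\<^sub>m n" n n]
  unfolding standard_space_def by (intro normal_space_Ob) auto

interpretation prob: presented_dagger_category Con "prob_spaces Gauss" space_rank gauss_class standard_space
proof
  fix X Y assume "X \<in> Ob (prob_spaces Gauss)" "Y \<in> Ob (prob_spaces Gauss)"
  then obtain m \<mu> \<Sigma> r L K n \<nu> \<Xi> s L' K' where "gauss_space X m \<mu> \<Sigma> r L K" "gauss_space Y n \<nu> \<Xi> s L' K'"
    by (metis gauss_spaceE)
  then interpret gauss_space_pair X m \<mu> \<Sigma> r L K Y n \<nu> \<Xi> s L' K' by (rule gauss_space_pair.intro)
  show "bij_betw (gauss_class X Y) (Mor Con (space_rank X) (space_rank Y)) (Mor (prob_spaces Gauss) X Y)"
    by (simp add: bij_betw_def X.rank Y.rank gauss_class_inj prob_spaces_Mor)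
  fix M assume "M \<in> Mor Con (space_rank X) (space_rank Y)"
  then show "Dag (prob_spaces Gauss) X Y (gauss_class X Y M)
      = gauss_class Y X (Dag Con (space_rank X) (space_rank Y) M)"
    by (simp add: Dag_gauss_class X.rank Y.rank)
next
  fix X assume "X \<in> Ob (prob_spaces Gauss)"
  then obtain m \<mu> \<Sigma> r L K where "gauss_space X m \<mu> \<Sigma> r L K" by (metis gauss_spaceE)
  then interpret gauss_space X m \<mu> \<Sigma> r L K .
  show "Ident (prob_spaces Gauss) X = gauss_class X X (Ident Con (space_rank X))"
    by (simp add: Ident_gauss_class rank)
next
  fix X Y Z M N
  assume "X \<in> Ob (prob_spaces Gauss)" "Y \<in> Ob (prob_spaces Gauss)" "Z \<in> Ob (prob_spaces Gauss)"
    and M: "M \<in> Mor Con (space_rank X) (space_rank Y)" and N: "N \<in> Mor Con (space_rank Y) (space_rank Z)"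
  then obtain m \<mu> \<Sigma> r L K n \<nu> \<Xi> s L' K' k \<xi> \<Upsilon> t L'' K''
    where *: "gauss_space X m \<mu> \<Sigma> r L K" "gauss_space Y n \<nu> \<Xi> s L' K'" "gauss_space Z k \<xi> \<Upsilon> t L'' K''"
    by (metis gauss_spaceE)
  show "Comp (prob_spaces Gauss) X Y Z (gauss_class Y Z N) (gauss_class X Y M)
      = gauss_class X Z (Comp Con (space_rank X) (space_rank Y) (space_rank Z) N M)"
    unfolding Con_sel by (rule Comp_gauss_class[OF *]) (use M N *[THEN gauss_space.rank] in simp_all)
qed (use standard_space_Ob in simp_all)

interpretation sample: presented_category CoIsom "sample_spaces Gauss" space_rank gauss_class standard_space
proof
  fix X Y assume "X \<in> Ob (sample_spaces Gauss)" "Y \<in> Ob (sample_spaces Gauss)"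
  then obtain m \<mu> \<Sigma> r L K n \<nu> \<Xi> s L' K' where "gauss_space X m \<mu> \<Sigma> r L K" "gauss_space Y n \<nu> \<Xi> s L' K'"
    by (metis gauss_spaceE sample_spaces_sel(1))
  then interpret gauss_space_pair X m \<mu> \<Sigma> r L K Y n \<nu> \<Xi> s L' K' by (rule gauss_space_pair.intro)
  show "bij_betw (gauss_class X Y) (Mor CoIsom (space_rank X) (space_rank Y)) (Mor (sample_spaces Gauss) X Y)"
    using inj_on_subset[OF gauss_class_inj CoIsom_subset_Con]
    by (simp add: bij_betw_def X.rank Y.rank sample_spaces_Mor)
next
  fix X Y Z M N
  assume o: "X \<in> Ob (sample_spaces Gauss)" "Y \<in> Ob (sample_spaces Gauss)" "Z \<in> Ob (sample_spaces Gauss)"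
    and m: "M \<in> Mor CoIsom (space_rank X) (space_rank Y)" "N \<in> Mor CoIsom (space_rank Y) (space_rank Z)"
  have "M \<in> Mor Con (space_rank X) (space_rank Y)" "N \<in> Mor Con (space_rank Y) (space_rank Z)"
    using m CoIsom_subset_Con by auto
  from prob.cl_comp[OF o[unfolded sample_spaces_sel] this]
  show "Comp (sample_spaces Gauss) X Y Z (gauss_class Y Z N) (gauss_class X Y M)
      = gauss_class X Z (Comp CoIsom (space_rank X) (space_rank Y) (space_rank Z) N M)"
    unfolding sample_spaces_sel CoIsom_sel Con_sel .
next
  fix X assume "X \<in> Ob (sample_spaces Gauss)"
  from prob.cl_ident[OF this[unfolded sample_spaces_sel]]
  show "Ident (sample_spaces Gauss) X = gauss_class X X (Ident CoIsom (space_rank X))"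
    unfolding sample_spaces_sel CoIsom_sel Con_sel .
qed (simp_all add: standard_space_Ob)

section \<open>Faithful spaces and the Cholesky isomorphism\<close>

text \<open>
  A positive semidefinite form \<open>|L\<^sup>T x|\<^sup>2\<close> vanishes only where \<open>L\<^sup>T x = 0\<close>, hence only on the null space of
  \<open>S = L L\<^sup>T\<close>.
\<close>

lemma positive_definite_iff_det:
  assumes S: "S \<in> carrier_mat n n" "positive_semidefinite S"
  shows "positive_definite S \<longleftrightarrow> det S \<noteq> 0"
proof
  assume pd: "positive_definite S"
  show "det S \<noteq> 0"
  proof
    assume "det S = 0"
    then obtain v where v: "v \<in> carrier_vec n" "v \<noteq> 0\<^sub>v n" "S *\<^sub>v v = 0\<^sub>v n"
      using det_0_iff_vec_prod_zero_field[OF S(1)] by blast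
    then have "0 < v \<bullet> 0\<^sub>v n" using positive_definiteD[OF pd S(1) v(1,2)] by simp
    then show False using v(1) by simp
  qed
next
  assume det: "det S \<noteq> 0"
  obtain r L K where "rank_factorization n r S L K" using rank_factorization_exists[OF S] by blast
  note L = rank_factorizationD[OF this]
  have "0 < x \<bullet> (S *\<^sub>v x)" if x: "x \<in> carrier_vec n" "x \<noteq> 0\<^sub>v n" for x
  proof -
    have y: "L\<^sup>T *\<^sub>v x \<in> carrier_vec r" using L(1) x by (auto intro: mult_mat_vec_carrier)
    have Sx: "S *\<^sub>v x = L *\<^sub>v (L\<^sup>T *\<^sub>v x)"
      using L(1) x unfolding L(4)[symmetric] by (intro assoc_mult_mat_vec) auto
    have "L *\<^sub>v 0\<^sub>v r = 0\<^sub>v n" using L(1) by (intro eq_vecI) auto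
    then have "L\<^sup>T *\<^sub>v x \<noteq> 0\<^sub>v r"
      using det x det_0_iff_vec_prod_zero_field[OF S(1)] Sx by metis
    then have "(L\<^sup>T *\<^sub>v x) \<bullet> (L\<^sup>T *\<^sub>v x) \<noteq> 0" using scalar_prod_self_eq_0[OF y] by simp
    then show ?thesis
      using gram_quadratic_form[OF L(1) x(1)] scalar_prod_self_nonneg[of "L\<^sup>T *\<^sub>v x"]
      unfolding L(4) by linarith
  qed
  then show "positive_definite S"
    using S by (simp add: positive_definite_def positive_semidefinite_def)
qed

lemma cholesky_invertible:
  assumes S: "S \<in> carrier_mat n n" "positive_definite S"
  obtains L K where "cholesky_factor n S L" "L \<in> carrier_mat n n" "L * L\<^sup>T = S"
    "K \<in> carrier_mat n n" "K * L = 1\<^sub>m n" "L * K = 1\<^sub>m n"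
proof -
  obtain r L K where f: "rank_factorization n r S L K" and c: "cholesky_factor n S L"
    using rank_factorization_exists[OF S(1) positive_definite_imp_positive_semidefinite[OF S(2)]] S(2)
    by blast
  note L = rank_factorizationD[OF f]
  have Ln: "L \<in> carrier_mat n n" using c by (simp add: cholesky_factor_def)
  then have "r = n" using L(1) by auto
  with L have K: "K \<in> carrier_mat n n" "K * L = 1\<^sub>m n" by auto
  show thesis by (rule that[OF c Ln L(4) K mat_mult_left_right_inverse[OF K(1) Ln K(2)]])
qed

text \<open>
  If \<open>S x = 0\<close> for some \<open>x \<noteq> 0\<close>, the linear functional \<open>x\<^sup>T\<close> is almost surely equal to the constant
  \<open>x \<bullet> b\<close> without being constant. Conversely, an invertible \<open>S\<close> lets the matrix of a kernel be
  recovered from its almost sure class, and then its offset and noise.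
\<close>

lemma faithful_iff_positive_definite:
  assumes b: "b \<in> carrier_vec n" and S: "S \<in> carrier_mat n n" "positive_semidefinite S"
  shows "faithful Gauss (n, normal_state n b S) \<longleftrightarrow> positive_definite S"
proof
  have sym: "S\<^sup>T = S" using S by (simp add: positive_semidefinite_def)
  assume faithful: "faithful Gauss (n, normal_state n b S)"
  show "positive_definite S"
  proof (rule ccontr)
    assume "\<not> positive_definite S"
    then have "det S = 0" using positive_definite_iff_det[OF S] by blast
    then obtain x where x: "x \<in> carrier_vec n" "x \<noteq> 0\<^sub>v n" "S *\<^sub>v x = 0\<^sub>v n"
      using det_0_iff_vec_prod_zero_field[OF S(1)] by blast
    \<comment> \<open>the row vector \<open>x\<^sup>T\<close>, a kernel to the line\<close>
    define A where "A = mat 1 n (\<lambda>(i, j). x $ j)"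
    have A: "A \<in> carrier_mat 1 n" by (simp add: A_def)
    have row: "row A 0 = x" using x(1) by (intro eq_vecI) (auto simp: A_def)
    have AS: "A * S = 0\<^sub>m 1 n"
    proof (rule eq_matI)
      fix i j assume ij: "i < dim_row (0\<^sub>m 1 n :: real mat)" "j < dim_col (0\<^sub>m 1 n :: real mat)"
      have "(A * S) $$ (i, j) = x \<bullet> col S j" using A S ij row by simp
      also have "\<dots> = row S j \<bullet> x"
        using sym S(1) ij x(1) comm_scalar_prod[of x n "col S j"] row_transpose[of j S] by simp
      also have "\<dots> = (S *\<^sub>v x) $ j" using S(1) ij by simp
      finally show "(A * S) $$ (i, j) = 0\<^sub>m 1 n $$ (i, j)" using x(3) ij by simp
    qed (use A S in auto)
    have "positive_semidefinite (0\<^sub>m 1 1)"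
      using gram_positive_semidefinite[of "0\<^sub>m 1 1" 1 1] by simp
    moreover have Ab: "A *\<^sub>v b \<in> carrier_vec 1" using A b by (rule mult_mat_vec_carrier)
    ultimately have "(A, 0\<^sub>v 1, 0\<^sub>m 1 1) \<in> Mor Gauss n 1" "(0\<^sub>m 1 n, A *\<^sub>v b, 0\<^sub>m 1 1) \<in> Mor Gauss n 1"
      using A by (simp_all only: Gauss_Mor zero_carrier_mat zero_carrier_vec)
    moreover have "as_eq Gauss n 1 (normal_state n b S) (A, 0\<^sub>v 1, 0\<^sub>m 1 1) (0\<^sub>m 1 n, A *\<^sub>v b, 0\<^sub>m 1 1)"
    proof -
      have "0\<^sub>m 1 n * S = 0\<^sub>m 1 n" "(0\<^sub>m 1 n :: real mat) *\<^sub>v b = 0\<^sub>v 1"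
        "A * S * A\<^sup>T = 0\<^sub>m 1 1" "0\<^sub>m 1 n * S * (0\<^sub>m 1 n)\<^sup>T = (0\<^sub>m 1 1 :: real mat)"
        using S b A AS by (auto intro!: eq_vecI)
      then show ?thesis
        using as_eq_normal[OF A zero_carrier_vec zero_carrier_mat zero_carrier_mat Ab zero_carrier_mat b S(1) sym] AS Ab
        by simp
    qed
    ultimately have "(A, 0\<^sub>v 1, 0\<^sub>m 1 1) = (0\<^sub>m 1 n, A *\<^sub>v b, 0\<^sub>m 1 1 :: real mat)"
      using faithful unfolding faithful_def Gauss_sel(1) by blast
    then have "row A 0 = 0\<^sub>v n" by simp
    then show False using row x(2) by simp
  qed
next
  assume "positive_definite S"
  then obtain L K where L: "L \<in> carrier_mat n n" "L * L\<^sup>T = S" "K \<in> carrier_mat n n" "K * L = 1\<^sub>m n" "L * K = 1\<^sub>m n"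
    using cholesky_invertible S(1) by metis
  have fact: "rank_factorization n n S L K" using L by (simp add: rank_factorization_def)
  have sym: "S\<^sup>T = S" using S by (simp add: positive_semidefinite_def)
  have "f = g" if "f \<in> Mor Gauss n k" "g \<in> Mor Gauss n k" "as_eq Gauss n k (normal_state n b S) f g" for k f g
  proof -
    obtain A c T A' c' T' where fg: "f = (A, c, T)" "g = (A', c', T')" by (metis prod.exhaust)
    have A: "A \<in> carrier_mat k n" "c \<in> carrier_vec k" "T \<in> carrier_mat k k"
      and A': "A' \<in> carrier_mat k n" "c' \<in> carrier_vec k" "T' \<in> carrier_mat k k"
      using that(1,2) fg by (auto simp: Gauss_Mor)
    have eqs: "A * S = A' * S" "c + A *\<^sub>v b = c' + A' *\<^sub>v b" "T + A * S * A\<^sup>T = T' + A' * S * A'\<^sup>T"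
      using that(3) unfolding fg as_eq_normal[OF A A' b S(1) sym] by auto
    have "X * L * K = X" if "X \<in> carrier_mat k n" for X
      using assoc_mult_mat[OF that L(1,3)] L(5) right_mult_one_mat[OF that] by simp
    moreover have "A * L = A' * L"
      using eqs(1) rank_factorization_mult_cancel[OF fact A(1) A'(1)] by blast
    ultimately have AA: "A = A'" using A(1) A'(1) by metis
    have "A * S * A\<^sup>T \<in> carrier_mat k k" using A S by auto
    then have "T = T'" using eqs(3) add_mat_right_cancel[OF A(3) A'(3)] unfolding AA by blast
    moreover have "c = c'"
    proof (rule eq_vecI)
      fix i assume "i < dim_vec c'"
      then have i: "i < k" using A' by simp
      have "A' *\<^sub>v b \<in> carrier_vec k" using A'(1) b by (rule mult_mat_vec_carrier)
      then have "(v + A' *\<^sub>v b) $ i = v $ i + (A' *\<^sub>v b) $ i" if "v \<in> carrier_vec k" for v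
        using that i A'(1) by simp
      then show "c $ i = c' $ i" using eqs(2) A(2) A'(2) unfolding AA by (metis add_right_cancel)
    qed (use A A' in simp)
    ultimately show ?thesis using fg AA by simp
  qed
  then show "faithful Gauss (n, normal_state n b S)" by (auto simp: faithful_def)
qed

text \<open>
  The coordinate matrix \<open>M\<close> of the noiseless kernel \<open>(L, b, 0)\<close> is a co-isometry. Invertibility of
  \<open>L\<close> gives \<open>M\<close> a left inverse as well, so \<open>M\<close> is orthogonal and \<open>M\<^sup>T\<close> labels the inverse class in
  both categories.
\<close>

lemma cholesky_isomorphism:
  assumes b: "b \<in> carrier_vec n" and L: "L \<in> carrier_mat n n" and K: "K \<in> carrier_mat n n" "K * L = 1\<^sub>m n"
  defines "l \<equiv> as_class Gauss n n (snd (standard_space n)) (L, b, 0\<^sub>m n n)"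
  shows "isomorphism (prob_spaces Gauss) (standard_space n) (n, normal_state n b (L * L\<^sup>T)) l"
    and "isomorphism (sample_spaces Gauss) (standard_space n) (n, normal_state n b (L * L\<^sup>T)) l"
proof -
  let ?S = "L * L\<^sup>T"
  let ?X = "standard_space n" and ?Y = "(n, normal_state n b ?S)"
  have S: "?S \<in> carrier_mat n n" "positive_semidefinite ?S"
    using L gram_positive_semidefinite by auto
  have one: "positive_semidefinite (1\<^sub>m n)" "positive_semidefinite (0\<^sub>m n n)"
    using gram_positive_semidefinite[of "1\<^sub>m n" n n] gram_positive_semidefinite[of "0\<^sub>m n n" n n] by simp_all
  obtain K0 where "gauss_space ?X n (0\<^sub>v n) (1\<^sub>m n) n (1\<^sub>m n) K0"
    using gauss_spaceI[of "0\<^sub>v n" n "1\<^sub>m n"] one(1)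
    unfolding standard_space_def[symmetric] space_rank_standard space_root_standard by auto
  then interpret X: gauss_space ?X n "0\<^sub>v n" "1\<^sub>m n" n "1\<^sub>m n" K0 .
  obtain K' where "gauss_space ?Y n b ?S (space_rank ?Y) (space_root ?Y) K'"
    using gauss_spaceI[OF b S] by blast
  moreover define s where "s = space_rank ?Y"
  moreover define L' where "L' = space_root ?Y"
  ultimately interpret Y: gauss_space ?Y n b ?S s L' K' by simp
  interpret gauss_space_pair ?X n "0\<^sub>v n" "1\<^sub>m n" n "1\<^sub>m n" K0 ?Y n b ?S s L' K' ..
  define M where "M = K' * (L * 1\<^sub>m n)"
  have mor: "(L, b, 0\<^sub>m n n) \<in> Mor Gauss n n" using L b one by (simp add: Gauss_Mor)
  have "L *\<^sub>v 0\<^sub>v n = 0\<^sub>v n" using L by (intro eq_vecI) auto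
  then have push: "Comp Gauss 0 n n (L, b, 0\<^sub>m n n) (normal_state n (0\<^sub>v n) (1\<^sub>m n)) = normal_state n b ?S"
    unfolding Comp_normal_state[OF L] using L b S(1) by simp
  have mem: "(L, b, 0\<^sub>m n n) \<in> gauss_class ?X ?Y M" and M: "M \<in> Mor Con n s"
    unfolding M_def by (fact gauss_class_of_morphism[OF mor push])+
  have l: "l = gauss_class ?X ?Y M"
    unfolding l_def using as_class_eq_gauss_class[OF mem] by (simp add: standard_space_def)
  have Mc: "M \<in> carrier_mat s n" using M by (simp add: Con_Mor)
  have MMT: "M * M\<^sup>T = 1\<^sub>m s" using noiseless_iff[OF mem Mc] by simp
  have LM: "L = L' * M" using mem L by (simp add: mem_gauss_class)
  have MTM: "M\<^sup>T * M = 1\<^sub>m n"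
  proof -
    \<comment> \<open>a left inverse of \<open>M\<close>, which then coincides with the right inverse \<open>M\<^sup>T\<close>\<close>
    define N where "N = K * L'"
    have N: "N \<in> carrier_mat n s" using K Y.L by (simp add: N_def)
    have NM: "N * M = 1\<^sub>m n"
      unfolding N_def using assoc_mult_mat[OF K(1) Y.L Mc] K(2) LM by simp
    have "M\<^sup>T = (N * M) * M\<^sup>T" using NM Mc by simp
    also have "\<dots> = N * (M * M\<^sup>T)" using N Mc by (intro assoc_mult_mat) auto
    finally have "M\<^sup>T = N" using MMT N by simp
    then show ?thesis using NM by simp
  qed
  have M': "M \<in> Mor CoIsom n s" "M\<^sup>T \<in> Mor CoIsom s n"
    using Mc MMT MTM by (simp_all add: CoIsom_Mor)
  then have "M \<in> Mor Con n s" "M\<^sup>T \<in> Mor Con s n" using CoIsom_subset_Con by auto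
  then have "inverses Con n s M M\<^sup>T" "inverses CoIsom n s M M\<^sup>T"
    using MMT MTM M' by (simp_all add: inverses_def)
  moreover have "?X \<in> Ob (prob_spaces Gauss)" "?Y \<in> Ob (prob_spaces Gauss)"
    using standard_space_Ob normal_space_Ob[OF b S] .
  ultimately show "isomorphism (prob_spaces Gauss) ?X ?Y l" "isomorphism (sample_spaces Gauss) ?X ?Y l"
    using prob.inverses_cl[of ?X ?Y M "M\<^sup>T"] sample.inverses_cl[of ?X ?Y M "M\<^sup>T"]
    unfolding l isomorphism_def Y.rank space_rank_standard sample_spaces_sel by blast+
qed

theorem proposition7:
  shows "(\<forall>n b S. b \<in> carrier_vec n \<and> S \<in> carrier_mat n n \<and> positive_semidefinite S \<longrightarrow>
            (faithful Gauss (n, normal_state n b S) \<longleftrightarrow> vec_space.rank n S = n) \<and>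
            (vec_space.rank n S = n \<longleftrightarrow> positive_definite S) \<and>
            (faithful Gauss (n, normal_state n b S) \<longrightarrow>
              (\<exists>L. cholesky_factor n S L \<and>
                (let l = as_class Gauss n n (snd (standard_space n)) (L, b, 0\<^sub>m n n)
                 in isomorphism (prob_spaces Gauss) (standard_space n) (n, normal_state n b S) l \<and>
                    isomorphism (sample_spaces Gauss) (standard_space n) (n, normal_state n b S) l)))) \<and>
         dagger_equivalent (prob_spaces Gauss) Con \<and>
         equivalent_categories (sample_spaces Gauss) CoIsom"
proof (intro conjI allI impI; (elim conjE)?)
  fix n and b :: "real vec" and S :: "real mat"
  assume b: "b \<in> carrier_vec n" and S: "S \<in> carrier_mat n n" "positive_semidefinite S"
  show rank: "vec_space.rank n S = n \<longleftrightarrow> positive_definite S"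
    using positive_definite_iff_det[OF S] vec_space.det_rank_iff[OF S(1)] by blast
  show "faithful Gauss (n, normal_state n b S) \<longleftrightarrow> vec_space.rank n S = n"
    using faithful_iff_positive_definite[OF b S] rank by blast
  assume "faithful Gauss (n, normal_state n b S)"
  then have "positive_definite S" using faithful_iff_positive_definite[OF b S] by blast
  then obtain L K where L: "cholesky_factor n S L" "L \<in> carrier_mat n n" "L * L\<^sup>T = S"
    "K \<in> carrier_mat n n" "K * L = 1\<^sub>m n"
    using cholesky_invertible S(1) by metis
  show "\<exists>L. cholesky_factor n S L \<and>
      (let l = as_class Gauss n n (snd (standard_space n)) (L, b, 0\<^sub>m n n)
       in isomorphism (prob_spaces Gauss) (standard_space n) (n, normal_state n b S) l \<and>
          isomorphism (sample_spaces Gauss) (standard_space n) (n, normal_state n b S) l)"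
    using cholesky_isomorphism[OF b L(2,4,5)] L(1) unfolding L(3) Let_def by blast
next
  show "dagger_equivalent (prob_spaces Gauss) Con" by (rule prob.dagger_equivalent)
next
  show "equivalent_categories (sample_spaces Gauss) CoIsom" by (rule sample.equivalent)
qed

end
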